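(* Let $0<a<1$ and $P_1,P_2>0$, and consider the one-sided Gaussian interference channel with weak interference $Y_1=X_1+Z_1$, $Y_2=aX_1+X_2+Z_2$, with unit-variance Gaussian noises and input power constraints $P_1,P_2$. Let $\mathcal{R_N}$ be its noiseberg region and $\mathcal{R_{HK}}$ its Han-Kobayashi region with Gaussian input and time sharing (both defined explicitly in the context). Then $\mathcal{R_N}=\mathcal{R_{HK}}$.
   Context: Channel: inputs $X_1,X_2$ are real, subject to average power constraints $P_1,P_2$; $Z_1,Z_2$ are Gaussian noises of unit variance, independent of the inputs; the channel is memoryless. Throughout $\bar\lambda=1-\lambda$, and $\log$ has a fixed base. Noiseberg region $\mathcal{R_N}$. For parameters $0\le\lambda<1$ and $h\ge 0$, put $$\frac{P_{1A}}{\bar\lambda}=P_1-\frac{P_2\lambda}{a^2\bar\lambda}-\lambda\min\Big\{h,\frac{1-a^2}{a^2}\Big\}-\max\Big\{0,h-\frac{1-a^2}{a^2}\Big\},$$ $$\frac{P_{1B}}{\lambda}=P_1+\frac{P_2}{a^2}+\bar\lambda\min\Big\{h,\frac{1-a^2}{a^2}\Big\},\qquad \frac{P_{1C}}{\bar\lambda}=\max\Big\{0,h-\frac{1-a^2}{a^2}\Big\}$$ (so $P_{1A}+P_{1B}+P_{1C}=P_1$). The pair $(\lambda,h)$ is admissible if $P_{1A}\ge 0$. $\mathcal{R_N}$ is the set of all nonnegative pairs $(R_1,R_2)$ for which there is an admissible $(\lambda,h)$ with $$R_1\le \bar\lambda R_{1\bar\lambda}+\lambda R_{1\lambda},\qquad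 R_2\le\bar\lambda R_{2\bar\lambda}$$ for some nonnegative $R_{1\bar\lambda},R_{2\bar\lambda},R_{1\lambda}$ satisfying $$R_{1\bar\lambda}\le\tfrac12\log\Big(1+\frac{P_{1A}}{\bar\lambda}\Big)+\tfrac12\log\left(1+\frac{a^2P_{1C}/\bar\lambda}{1+a^2P_{1A}/\bar\lambda+P_2/\bar\lambda}\right),$$ $$R_{2\bar\lambda}\le\tfrac12\log\left(1+\frac{P_2/\bar\lambda}{1+a^2P_{1A}/\bar\lambda}\right),\qquad R_{1\lambda}\le\tfrac12\log\Big(1+\frac{P_{1B}}{\lambda}\Big),$$ where for $\lambda=0$ the ratio $P_{1B}/\lambda$ is read as the value given by its formula and $P_{1B}=0$ (so the term $\lambda R_{1\lambda}$ vanishes). Han-Kobayashi region with Gaussian input $\mathcal{R_{HK}}$. It is the set of all nonnegative pairs $(R_1,R_2)$ for which there exist $q\in\mathbb{N}$, $q\ge1$, and for $i=1,\dots,q$ numbers $\alpha_i\in[0,1]$, $\bar\alpha_i=1-\alpha_i$, $\lambda_i\ge 0$, $P_{1i}\ge0$, $P_{2i}\ge 0$ with $\sum_i\lambda_i=1$, $\sum_i\lambda_iP_{1i}\le P_1$, $\sum_i\lambda_iP_{2i}\le P_2$, such that $$R_1\le\sum_{i=1}^q\lambda_i\,\tfrac12\log(1+P_{1i}),\qquad R_2\le\sum_{i=1}^q\lambda_i\,\tfrac12\log\Big(1+\frac{P_{2i}}{1+a^2\alpha_iP_{1i}}\Big),$$ $$R_1+R_2\le\sum_{i=1}^q\lambda_i\Big\{\tfrac12\log\Big(1+\frac{P_{2i}+a^2\bar\alpha_iP_{1i}}{1+a^2\alpha_iP_{1i}}\Big)+\tfrac12\log(1+\alpha_iP_{1i})\Big\}.$$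 *)

theory Defs
  imports Complex_Main
begin

text \<open>
  The functions \<open>nb_pA\<close>, \<open>nb_pB\<close>, \<open>nb_pC\<close> are the ratios \<open>P\<^sub>1\<^sub>A/(1-\<lambda>)\<close>, \<open>P\<^sub>1\<^sub>B/\<lambda>\<close>, \<open>P\<^sub>1\<^sub>C/(1-\<lambda>)\<close>,
  so \<open>nb_pB\<close> has the value of its formula also at \<open>\<lambda> = 0\<close>, where \<open>nb_P1B\<close> is \<open>0\<close>.
\<close>

definition nb_pA :: "real \<Rightarrow> real \<Rightarrow> real \<Rightarrow> real \<Rightarrow> real \<Rightarrow> real" where
  "nb_pA a P1 P2 lam h =
     P1 - P2 * lam / (a\<^sup>2 * (1 - lam)) - lam * min h ((1 - a\<^sup>2) / a\<^sup>2)
        - max 0 (h - (1 - a\<^sup>2) / a\<^sup>2)"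

definition nb_pB :: "real \<Rightarrow> real \<Rightarrow> real \<Rightarrow> real \<Rightarrow> real \<Rightarrow> real" where
  "nb_pB a P1 P2 lam h = P1 + P2 / a\<^sup>2 + (1 - lam) * min h ((1 - a\<^sup>2) / a\<^sup>2)"

definition nb_pC :: "real \<Rightarrow> real \<Rightarrow> real" where
  "nb_pC a h = max 0 (h - (1 - a\<^sup>2) / a\<^sup>2)"

definition nb_P1A :: "real \<Rightarrow> real \<Rightarrow> real \<Rightarrow> real \<Rightarrow> real \<Rightarrow> real" where
  "nb_P1A a P1 P2 lam h = (1 - lam) * nb_pA a P1 P2 lam h"

definition nb_P1B :: "real \<Rightarrow> real \<Rightarrow> real \<Rightarrow> real \<Rightarrow> real \<Rightarrow> real" where
  "nb_P1B a P1 P2 lam h = lam * nb_pB a P1 P2 lam h"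

definition nb_P1C :: "real \<Rightarrow> real \<Rightarrow> real \<Rightarrow> real" where
  "nb_P1C a lam h = (1 - lam) * nb_pC a h"

lemma nb_power_sum:
  assumes "a \<noteq> 0" "lam < 1"
  shows "nb_P1A a P1 P2 lam h + nb_P1B a P1 P2 lam h + nb_P1C a lam h = P1"
  using assms
  by (simp add: nb_P1A_def nb_P1B_def nb_P1C_def nb_pA_def nb_pB_def nb_pC_def field_simps)

definition nb_admissible :: "real \<Rightarrow> real \<Rightarrow> real \<Rightarrow> real \<Rightarrow> real \<Rightarrow> bool" where
  "nb_admissible a P1 P2 lam h \<longleftrightarrow>
     0 \<le> lam \<and> lam < 1 \<and> 0 \<le> h \<and> 0 \<le> nb_P1A a P1 P2 lam h"

text \<open>In both regions \<open>b\<close> is the base of the logarithm.\<close>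

definition noiseberg_region :: "real \<Rightarrow> real \<Rightarrow> real \<Rightarrow> real \<Rightarrow> (real \<times> real) set" where
  "noiseberg_region b a P1 P2 =
     {(R1, R2). 0 \<le> R1 \<and> 0 \<le> R2 \<and>
       (\<exists>lam h. nb_admissible a P1 P2 lam h \<and>
         (\<exists>R1' R2' R1''. 0 \<le> R1' \<and> 0 \<le> R2' \<and> 0 \<le> R1'' \<and>
            R1 \<le> (1 - lam) * R1' + lam * R1'' \<and>
            R2 \<le> (1 - lam) * R2' \<and>
            R1' \<le> 1/2 * log b (1 + nb_pA a P1 P2 lam h)
                 + 1/2 * log b (1 + a\<^sup>2 * nb_pC a h
                      / (1 + a\<^sup>2 * nb_pA a P1 P2 lam h + P2 / (1 - lam))) \<and>
            R2' \<le> 1/2 * log b (1 + (P2 / (1 - lam)) / (1 + a\<^sup>2 * nb_pA a P1 P2 lam h)) \<and>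
            R1'' \<le> 1/2 * log b (1 + nb_pB a P1 P2 lam h)))}"

definition HK_region :: "real \<Rightarrow> real \<Rightarrow> real \<Rightarrow> real \<Rightarrow> (real \<times> real) set" where
  "HK_region b a P1 P2 =
     {(R1, R2). 0 \<le> R1 \<and> 0 \<le> R2 \<and>
       (\<exists>(q::nat) (\<alpha>::nat \<Rightarrow> real) (lam::nat \<Rightarrow> real) (p1::nat \<Rightarrow> real) (p2::nat \<Rightarrow> real).
          1 \<le> q \<and>
          (\<forall>i\<in>{1..q}. 0 \<le> \<alpha> i \<and> \<alpha> i \<le> 1 \<and> 0 \<le> lam i \<and> 0 \<le> p1 i \<and> 0 \<le> p2 i) \<and>
          (\<Sum>i=1..q. lam i) = 1 \<and>
          (\<Sum>i=1..q. lam i * p1 i) \<le> P1 \<and>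
          (\<Sum>i=1..q. lam i * p2 i) \<le> P2 \<and>
          R1 \<le> (\<Sum>i=1..q. lam i * (1/2 * log b (1 + p1 i))) \<and>
          R2 \<le> (\<Sum>i=1..q. lam i * (1/2 * log b (1 + p2 i / (1 + a\<^sup>2 * \<alpha> i * p1 i)))) \<and>
          R1 + R2 \<le> (\<Sum>i=1..q. lam i *
             (1/2 * log b (1 + (p2 i + a\<^sup>2 * (1 - \<alpha> i) * p1 i) / (1 + a\<^sup>2 * \<alpha> i * p1 i))
              + 1/2 * log b (1 + \<alpha> i * p1 i))))}"

end

theory Submission
  imports Defs "HOL-Analysis.Analysis"
begin

text \<open>
  Put \<open>c = a\<^sup>2\<close>, \<open>d = 1 - c\<close>, and describe a mode of a Han-Kobayashi time-sharing scheme by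
  \<open>v = 1 + c \<alpha> P\<^sub>1\<close>, \<open>k = v + P\<^sub>2\<close>, \<open>z = 1 + c P\<^sub>1 + P\<^sub>2\<close>, so that \<open>1 \<le> v \<le> k \<le> z\<close>. For a
  given \<open>R\<^sub>2\<close> an optimal mixture of modes maximises a Lagrangian that is concave in \<open>(k, z)\<close> plus
  a function of \<open>v\<close> alone, whose derivative has the sign of a quadratic positive at \<open>0\<close>. Hence
  there is at most one maximal mode with \<open>P\<^sub>2 > 0\<close>, and at most one with \<open>P\<^sub>2 = 0\<close>, for which
  \<open>v = k = z = z\<^sub>2\<close>. The first-order conditions relating these two modes say precisely that
  they form a noiseberg scheme, with \<open>h = (z\<^sub>2 - k) / c\<close>.
\<close>

section \<open>One-sided derivatives, weighted means and Jensen's inequality\<close>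

lemma derivative_nonpos_if_right_max:
  fixes f :: "real \<Rightarrow> real"
  assumes "(f has_real_derivative D) (at 0)" and "0 < e"
    and "\<And>s. 0 < s \<Longrightarrow> s < e \<Longrightarrow> f s \<le> f 0"
  shows "D \<le> 0"
proof (rule ccontr)
  assume "\<not> D \<le> 0"
  then obtain d where "0 < d" and d: "\<And>s. 0 < s \<Longrightarrow> s < d \<Longrightarrow> f 0 < f (0 + s)"
    using DERIV_pos_inc_right[OF assms(1)] by auto
  define s where "s = min d e / 2"
  have "0 < s" "s < d" "s < e" using \<open>0 < d\<close> \<open>0 < e\<close> by (auto simp: s_def)
  then show False using d[of s] assms(3)[of s] by simp
qed

text \<open>The nonnegative terms \<open>w i * (M - g i)\<close> add up to at most 0, so each of
  them vanishes. This serves for equality in Jensen's inequality and for passing from an optimal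
  mixture to the optimality of its single modes.\<close>

lemma sum_weighted_eq_bound:
  fixes w g :: "'i \<Rightarrow> real"
  assumes "finite A" "\<And>i. i \<in> A \<Longrightarrow> 0 \<le> w i" "sum w A = 1"
    and "\<And>i. i \<in> A \<Longrightarrow> g i \<le> M" and "M \<le> (\<Sum>i\<in>A. w i * g i)"
    and "i \<in> A" "0 < w i"
  shows "g i = M"
proof -
  have "(\<Sum>i\<in>A. w i * (M - g i)) = M - (\<Sum>i\<in>A. w i * g i)"
    using assms(3) by (simp add: right_diff_distrib sum_subtractf flip: sum_distrib_right)
  moreover have "0 \<le> w i * (M - g i)" if "i \<in> A" for i
    using assms(2,4) that by simp
  ultimately have "w i * (M - g i) = 0"
    using assms(1,5,6) by (metis (no_types, lifting) diff_le_0_iff_le order_antisym_conv sum_nonneg sum_nonneg_eq_0_iff)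
  then show ?thesis using assms(7) by simp
qed

lemma ln_tangent:
  fixes s S :: real
  assumes "0 < s" "0 < S"
  shows "ln s \<le> ln S + (s / S - 1)" and "ln s = ln S + (s / S - 1) \<Longrightarrow> s = S"
  using ln_le_minus_one[of "s / S"] ln_eq_minus_one[of "s / S"] assms
  by (auto simp: ln_div)

lemma ln_jensen:
  fixes w s :: "'i \<Rightarrow> real"
  assumes "finite A" "\<And>i. i \<in> A \<Longrightarrow> 0 \<le> w i" "sum w A = 1"
    and "\<And>i. i \<in> A \<Longrightarrow> 0 < s i" "(\<Sum>i\<in>A. w i * s i) \<le> S" "0 < S"
  shows "(\<Sum>i\<in>A. w i * ln (s i)) \<le> ln S"
    and "ln S \<le> (\<Sum>i\<in>A. w i * ln (s i)) \<Longrightarrow> i \<in> A \<Longrightarrow> 0 < w i \<Longrightarrow> s i = S"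
proof -
  \<comment> \<open>\<open>g\<close> never exceeds \<open>ln S\<close>, by the tangent of
    \<open>ln\<close> at \<open>S\<close>. As the mean of \<open>s\<close> is at most
    \<open>S\<close>, the mean of \<open>g\<close> is no smaller than that of \<open>ln\<close>.
    Equality of the means forces equality in the tangent bound, which holds only at
    \<open>S\<close>.\<close>
  define g where "g i = ln (s i) - (s i / S - 1)" for i
  have g: "g i \<le> ln S" if "i \<in> A" for i
    using ln_tangent(1)[of "s i" S] assms(4,6) that by (simp add: g_def)
  have "(\<Sum>i\<in>A. w i * g i) = (\<Sum>i\<in>A. w i * ln (s i)) - (\<Sum>i\<in>A. w i * s i) / S + 1"
    using assms(3) by (simp add: g_def algebra_simps sum.distrib sum_subtractf sum_divide_distrib)
  moreover have "(\<Sum>i\<in>A. w i * s i) / S \<le> 1" using assms(5,6) by simp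
  ultimately have lb: "(\<Sum>i\<in>A. w i * ln (s i)) \<le> (\<Sum>i\<in>A. w i * g i)" by linarith
  have "(\<Sum>i\<in>A. w i * g i) \<le> (\<Sum>i\<in>A. w i * ln S)"
    using g assms(2) by (intro sum_mono mult_left_mono) auto
  also have "\<dots> = ln S" using assms(3) by (simp flip: sum_distrib_right)
  finally show "(\<Sum>i\<in>A. w i * ln (s i)) \<le> ln S" using lb by linarith
  assume "ln S \<le> (\<Sum>i\<in>A. w i * ln (s i))" "i \<in> A" "0 < w i"
  then have "g i = ln S"
    using sum_weighted_eq_bound[OF assms(1-3) g] lb by fastforce
  then show "s i = S"
    using ln_tangent(2)[of "s i" S] assms(4,6) \<open>i \<in> A\<close> by (simp add: g_def)
qed

section \<open>Lagrange multipliers for an optimal mixture\<close>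

text \<open>The convex hull of the image of \<open>K\<close> under \<open>(f, g, c1, c2)\<close> is
  compact, so some mixture is optimal. A hyperplane separating the hull from the points that meet
  the constraints and beat the optimum has the multipliers as coefficients. All used modes of the
  optimal mixture then maximise one Lagrangian.\<close>

lemma optimal_mixture_multipliers:
  fixes K :: "'a::topological_space set" and f g c1 c2 :: "'a \<Rightarrow> real" and G C1 C2 :: real
  assumes "compact K" "continuous_on K f" "continuous_on K g" "continuous_on K c1" "continuous_on K c2"
    and slater: "p0 \<in> K" "G < g p0" "c1 p0 < C1" "c2 p0 < C2"
    and feas: "\<forall>i\<in>{1..n}. 0 \<le> w i \<and> p i \<in> K" "sum w {1..n::nat} = 1"
      "G \<le> (\<Sum>i=1..n. w i * g (p i))" "(\<Sum>i=1..n. w i * c1 (p i)) \<le> C1" "(\<Sum>i=1..n. w i * c2 (p i)) \<le> C2"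
  obtains n' w' p' t \<mu>1 \<mu>2 where
    "\<forall>i\<in>{1..n'}. 0 \<le> w' i \<and> p' i \<in> K" "sum w' {1..n'::nat} = 1"
    "G \<le> (\<Sum>i=1..n'. w' i * g (p' i))" "(\<Sum>i=1..n'. w' i * c1 (p' i)) \<le> C1" "(\<Sum>i=1..n'. w' i * c2 (p' i)) \<le> C2"
    "(\<Sum>i=1..n. w i * f (p i)) \<le> (\<Sum>i=1..n'. w' i * f (p' i))"
    "0 \<le> t" "0 \<le> \<mu>1" "0 \<le> \<mu>2"
    "0 < t \<longrightarrow> (\<Sum>i=1..n'. w' i * g (p' i)) = G"
    "0 < \<mu>1 \<longrightarrow> (\<Sum>i=1..n'. w' i * c1 (p' i)) = C1"
    "0 < \<mu>2 \<longrightarrow> (\<Sum>i=1..n'. w' i * c2 (p' i)) = C2"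
    "\<forall>i\<in>{1..n'}. 0 < w' i \<longrightarrow> (\<forall>q\<in>K.
       f q + t * g q - \<mu>1 * c1 q - \<mu>2 * c2 q \<le> f (p' i) + t * g (p' i) - \<mu>1 * c1 (p' i) - \<mu>2 * c2 (p' i))"
proof -
  define \<Phi> where "\<Phi> q = (f q, g q, c1 q, c2 q)" for q
  define C where "C = convex hull (\<Phi> ` K)"
  define B where "B = (UNIV :: real set) \<times> {G..} \<times> {..C1} \<times> {..C2}"
  have sum\<Phi>: "(\<Sum>i=1..n. w i *\<^sub>R \<Phi> (p i)) =
      (\<Sum>i=1..n. w i * f (p i), \<Sum>i=1..n. w i * g (p i), \<Sum>i=1..n. w i * c1 (p i), \<Sum>i=1..n. w i * c2 (p i))"
    for n :: nat and w :: "nat \<Rightarrow> real" and p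
    by (simp add: \<Phi>_def sum_prod)
  have "compact C"
    unfolding C_def \<Phi>_def
    by (intro compact_convex_hull compact_continuous_image continuous_on_Pair assms)
  moreover have "closed B" unfolding B_def by (intro closed_Times) auto
  ultimately have "compact (C \<inter> B)" by blast
  have "(\<Sum>i=1..n. w i *\<^sub>R \<Phi> (p i)) \<in> C"
    unfolding C_def using feas(1,2)
    by (intro convex_sum convex_convex_hull) (auto intro: hull_inc)
  moreover have "(\<Sum>i=1..n. w i *\<^sub>R \<Phi> (p i)) \<in> B"
    unfolding sum\<Phi> B_def using feas(3-5) by simp
  ultimately have in_CB: "(\<Sum>i=1..n. w i *\<^sub>R \<Phi> (p i)) \<in> C \<inter> B" by blast
  have "\<exists>d\<in>C \<inter> B. \<forall>s\<in>C \<inter> B. fst s \<le> fst d"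
    using in_CB by (intro continuous_attains_sup \<open>compact (C \<inter> B)\<close> continuous_intros) auto
  then obtain d where d: "d \<in> C \<inter> B" and dmax: "\<And>s. s \<in> C \<inter> B \<Longrightarrow> fst s \<le> fst d"
    by blast
  obtain n' w' x' where w': "\<forall>i\<in>{1..n'::nat}. 0 \<le> w' i \<and> x' i \<in> \<Phi> ` K" "sum w' {1..n'} = 1"
    "(\<Sum>i=1..n'. w' i *\<^sub>R x' i) = d"
    using d unfolding C_def convex_hull_indexed by blast
  have "\<forall>i\<in>{1..n'}. \<exists>q. q \<in> K \<and> x' i = \<Phi> q" using w'(1) by blast
  from bchoice[OF this] obtain p' where p': "\<forall>i\<in>{1..n'}. p' i \<in> K \<and> x' i = \<Phi> (p' i)"
    by blast
  have d_eq: "d = (\<Sum>i=1..n'. w' i *\<^sub>R \<Phi> (p' i))"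
    unfolding w'(3)[symmetric] using p' by (intro sum.cong) auto
  note d_eq' = d_eq[unfolded sum\<Phi>]
  define Q where "Q = {fst d<..} \<times> {G..} \<times> {..C1} \<times> {..C2}"
  have "convex Q" unfolding Q_def by (intro convex_Times) auto
  moreover have "C \<inter> Q = {}" using dmax by (fastforce simp: Q_def B_def)
  moreover have "convex C" by (simp add: C_def convex_convex_hull)
  moreover have "C \<noteq> {}" using d by blast
  moreover have "Q \<noteq> {}" unfolding Q_def by auto
  ultimately have "\<exists>v \<beta>. v \<noteq> 0 \<and> (\<forall>s\<in>C. inner v s \<le> \<beta>) \<and> (\<forall>s\<in>Q. \<beta> \<le> inner v s)"
    by (intro separating_hyperplane_sets)
  then obtain v \<beta> where v: "v \<noteq> 0" "\<And>s. s \<in> C \<Longrightarrow> inner v s \<le> \<beta>" "\<And>s. s \<in> Q \<Longrightarrow> \<beta> \<le> inner v s"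
    by blast
  obtain \<alpha> \<tau> m1 m2 where v_eq: "v = (\<alpha>, \<tau>, - m1, - m2)"
    by (metis minus_minus prod.exhaust)
  have up: "\<beta> \<le> \<alpha> * A + \<tau> * b - m1 * x - m2 * y" if "fst d < A" "G \<le> b" "x \<le> C1" "y \<le> C2" for A b x y
    using v(3)[of "(A, b, x, y)"] that by (simp add: Q_def v_eq inner_Pair)
  have lo: "\<alpha> * f q + \<tau> * g q - m1 * c1 q - m2 * c2 q \<le> \<beta>" if "q \<in> K" for q
    using v(2)[of "\<Phi> q"] that by (simp add: C_def \<Phi>_def v_eq inner_Pair hull_inc)
  \<comment> \<open>An affine function bounded below on the half-line has nonnegative slope. Moving
    one coordinate of a point of \<open>Q\<close> off to infinity thus gives the sign of each
    coefficient.\<close>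
  have unb: "0 \<le> k" if "\<And>s. 0 \<le> s \<Longrightarrow> e \<le> r + k * s" for k e r :: real
  proof (rule ccontr)
    assume "\<not> 0 \<le> k"
    define s where "s = (\<bar>r - e\<bar> + 1) / - k"
    have s0: "0 \<le> s" unfolding s_def using \<open>\<not> 0 \<le> k\<close> by (intro divide_nonneg_pos) auto
    have "k * s = - (\<bar>r - e\<bar> + 1)" using \<open>\<not> 0 \<le> k\<close> by (simp add: s_def)
    with that[OF s0] show False by linarith
  qed
  have \<alpha>0: "0 \<le> \<alpha>"
    by (rule unb[of \<beta> "\<alpha> * (fst d + 1) + \<tau> * G - m1 * C1 - m2 * C2"])
       (use up[of "fst d + 1 + _" G C1 C2] in \<open>simp add: algebra_simps\<close>)
  have \<tau>0: "0 \<le> \<tau>"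
    by (rule unb[of \<beta> "\<alpha> * (fst d + 1) + \<tau> * G - m1 * C1 - m2 * C2"])
       (use up[of "fst d + 1" "G + _" C1 C2] in \<open>simp add: algebra_simps\<close>)
  have m10: "0 \<le> m1"
    by (rule unb[of \<beta> "\<alpha> * (fst d + 1) + \<tau> * G - m1 * C1 - m2 * C2"])
       (use up[of "fst d + 1" G "C1 - _" C2] in \<open>simp add: algebra_simps\<close>)
  have m20: "0 \<le> m2"
    by (rule unb[of \<beta> "\<alpha> * (fst d + 1) + \<tau> * G - m1 * C1 - m2 * C2"])
       (use up[of "fst d + 1" G C1 "C2 - _"] in \<open>simp add: algebra_simps\<close>)
  \<comment> \<open>\<open>Q\<close> is open at \<open>fst d\<close>, so its corner is reached only
    in the limit.\<close>
  have \<beta>_le: "\<beta> \<le> \<alpha> * fst d + \<tau> * G - m1 * C1 - m2 * C2"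
  proof (rule field_le_epsilon)
    fix e :: real assume "0 < e"
    have "\<alpha> * (e / (\<alpha> + 1)) \<le> e" using \<alpha>0 \<open>0 < e\<close> by (simp add: field_simps)
    moreover have "0 < e / (\<alpha> + 1)" using \<alpha>0 \<open>0 < e\<close> by simp
    ultimately show "\<beta> \<le> \<alpha> * fst d + \<tau> * G - m1 * C1 - m2 * C2 + e"
      using up[of "fst d + e / (\<alpha> + 1)" G C1 C2] by (simp add: distrib_left)
  qed
  \<comment> \<open>The Slater point meets all three constraints strictly. Without weight on
    \<open>f\<close> it would force the other coefficients, hence the normal \<open>v\<close>, to
    vanish.\<close>
  have "\<alpha> \<noteq> 0"
  proof
    assume "\<alpha> = 0"
    have "0 \<le> \<tau> * (g p0 - G)" "0 \<le> m1 * (C1 - c1 p0)" "0 \<le> m2 * (C2 - c2 p0)"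
      using slater \<tau>0 m10 m20 by auto
    moreover have "\<tau> * (g p0 - G) + m1 * (C1 - c1 p0) + m2 * (C2 - c2 p0) \<le> 0"
      using lo[OF slater(1)] \<beta>_le \<open>\<alpha> = 0\<close> by (simp add: algebra_simps)
    ultimately have "\<tau> * (g p0 - G) = 0" "m1 * (C1 - c1 p0) = 0" "m2 * (C2 - c2 p0) = 0"
      by linarith+
    then show False using slater v(1) \<open>\<alpha> = 0\<close> by (simp add: v_eq zero_prod_def)
  qed
  with \<alpha>0 have \<alpha>: "0 < \<alpha>" by simp
  define t \<mu>1 \<mu>2 where "t = \<tau> / \<alpha>" "\<mu>1 = m1 / \<alpha>" "\<mu>2 = m2 / \<alpha>"
  define L where "L q = f q + t * g q - \<mu>1 * c1 q - \<mu>2 * c2 q" for q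
  define M where "M = fst d + t * G - \<mu>1 * C1 - \<mu>2 * C2"
  have nn: "0 \<le> t" "0 \<le> \<mu>1" "0 \<le> \<mu>2" using \<alpha> \<tau>0 m10 m20 by (auto simp: t_\<mu>1_\<mu>2_def)
  have L_le: "L q \<le> M" if "q \<in> K" for q
  proof -
    have "\<alpha> * f q + \<tau> * g q - m1 * c1 q - m2 * c2 q \<le> \<alpha> * fst d + \<tau> * G - m1 * C1 - m2 * C2"
      using lo[OF that] \<beta>_le by linarith
    also have "\<alpha> * f q + \<tau> * g q - m1 * c1 q - m2 * c2 q = \<alpha> * L q"
      using \<alpha> by (simp add: L_def t_\<mu>1_\<mu>2_def algebra_simps)
    also have "\<alpha> * fst d + \<tau> * G - m1 * C1 - m2 * C2 = \<alpha> * M"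
      using \<alpha> by (simp add: M_def t_\<mu>1_\<mu>2_def algebra_simps)
    finally show ?thesis using \<alpha> by simp
  qed
  have feas': "G \<le> (\<Sum>i=1..n'. w' i * g (p' i))" "(\<Sum>i=1..n'. w' i * c1 (p' i)) \<le> C1"
    "(\<Sum>i=1..n'. w' i * c2 (p' i)) \<le> C2"
    using d by (auto simp: d_eq' B_def)
  have sumL: "(\<Sum>i=1..n'. w' i * L (p' i)) = fst d + t * (\<Sum>i=1..n'. w' i * g (p' i))
      - \<mu>1 * (\<Sum>i=1..n'. w' i * c1 (p' i)) - \<mu>2 * (\<Sum>i=1..n'. w' i * c2 (p' i))"
    by (simp add: L_def d_eq' algebra_simps sum.distrib sum_subtractf sum_distrib_left)
  have slack: "0 \<le> t * ((\<Sum>i=1..n'. w' i * g (p' i)) - G)" "0 \<le> \<mu>1 * (C1 - (\<Sum>i=1..n'. w' i * c1 (p' i)))"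
    "0 \<le> \<mu>2 * (C2 - (\<Sum>i=1..n'. w' i * c2 (p' i)))"
    using nn feas' by auto
  \<comment> \<open>Feasibility bounds the mean of \<open>L\<close> below by \<open>M\<close>, and
    \<open>L_le\<close> bounds it above. Equality yields both complementary slackness and
    \<open>L = M\<close> at every used mode.\<close>
  have M_le: "M \<le> (\<Sum>i=1..n'. w' i * L (p' i))"
    using slack unfolding sumL M_def by (simp add: algebra_simps)
  have "(\<Sum>i=1..n'. w' i * L (p' i)) \<le> (\<Sum>i=1..n'. w' i * M)"
    using w' p' L_le by (intro sum_mono mult_left_mono) auto
  also have "\<dots> = M" using w'(2) by (simp flip: sum_distrib_right)
  finally have "t * ((\<Sum>i=1..n'. w' i * g (p' i)) - G) + \<mu>1 * (C1 - (\<Sum>i=1..n'. w' i * c1 (p' i)))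
    + \<mu>2 * (C2 - (\<Sum>i=1..n'. w' i * c2 (p' i))) \<le> 0"
    unfolding sumL M_def by (simp add: algebra_simps)
  then have cs: "t * ((\<Sum>i=1..n'. w' i * g (p' i)) - G) = 0" "\<mu>1 * (C1 - (\<Sum>i=1..n'. w' i * c1 (p' i))) = 0"
    "\<mu>2 * (C2 - (\<Sum>i=1..n'. w' i * c2 (p' i))) = 0"
    using slack by linarith+
  show thesis
  proof (rule that[of n' w' p' t \<mu>1 \<mu>2])
    show "(\<Sum>i=1..n. w i * f (p i)) \<le> (\<Sum>i=1..n'. w' i * f (p' i))"
      using dmax[OF in_CB] unfolding sum\<Phi> by (simp add: d_eq')
    have "L q \<le> L (p' i)" if i: "i \<in> {1..n'}" "0 < w' i" and "q \<in> K" for i q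
      using sum_weighted_eq_bound[of "{1..n'}" w' "\<lambda>i. L (p' i)" M i] w' p' L_le M_le that by auto
    then show "\<forall>i\<in>{1..n'}. 0 < w' i \<longrightarrow> (\<forall>q\<in>K.
       f q + t * g q - \<mu>1 * c1 q - \<mu>2 * c2 q
         \<le> f (p' i) + t * g (p' i) - \<mu>1 * c1 (p' i) - \<mu>2 * c2 (p' i))"
      by (simp add: L_def)
  qed (use w' p' nn feas' cs in auto)
qed

section \<open>Maximal modes of the Lagrangian\<close>

text \<open>This is the monotonicity of the derivative of \<open>ln\<close>. The expression arises
  when the first-order conditions at two maxima, each in the direction of the other, are
  added.\<close>

lemma inverse_diff_mono:
  fixes x y :: real
  assumes "0 < x" "0 < y"
  shows "0 \<le> (y - x) / x - (y - x) / y" and "(y - x) / x - (y - x) / y \<le> 0 \<Longrightarrow> x = y"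
proof -
  have *: "(y - x) / x - (y - x) / y = (y - x)\<^sup>2 / (x * y)"
    using assms by (simp add: field_simps power2_eq_square)
  show "0 \<le> (y - x) / x - (y - x) / y" using assms by (simp add: *)
  show "x = y" if "(y - x) / x - (y - x) / y \<le> 0"
    using that assms unfolding * by (simp add: divide_le_0_iff mult_le_0_iff)
qed

text \<open>
  The bound \<open>T\<close> makes the set of modes compact; \<open>\<nu>\<close> is the price of \<open>c P\<^sub>1 = z - k + v - 1\<close>
  and \<open>\<mu>\<close> that of \<open>P\<^sub>2 = k - v\<close>.
\<close>

locale hk_lagrangian =
  fixes d t \<nu> \<mu> T :: real
  assumes d: "0 < d" "d < 1" and t: "0 \<le> t"
begin

text \<open>Up to the factor \<open>2 * ln b\<close> and the constant \<open>ln c\<close>, with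
  \<open>c = 1 - d\<close>, the first three terms are the bound of a mode on \<open>R1 + R2\<close>,
  and the term at \<open>t\<close> is its bound on \<open>R2\<close>.\<close>

definition L :: "real \<Rightarrow> real \<Rightarrow> real \<Rightarrow> real" where
  "L v k z = ln z + ln (v - d) - ln v + t * (ln k - ln v) - \<nu> * (z - k + v - 1) - \<mu> * (k - v)"

definition feasible :: "real \<Rightarrow> real \<Rightarrow> real \<Rightarrow> bool" where
  "feasible v k z \<longleftrightarrow> 1 \<le> v \<and> v \<le> k \<and> k \<le> z \<and> z \<le> T"

definition maximal :: "real \<Rightarrow> real \<Rightarrow> real \<Rightarrow> bool" where
  "maximal v k z \<longleftrightarrow> feasible v k z \<and> (\<forall>v' k' z'. feasible v' k' z' \<longrightarrow> L v' k' z' \<le> L v k z)"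

lemma maximalD:
  assumes "maximal v k z"
  shows "1 \<le> v" "v \<le> k" "k \<le> z" "z \<le> T" "feasible v' k' z' \<Longrightarrow> L v' k' z' \<le> L v k z"
  using assms by (auto simp: maximal_def feasible_def)

text \<open>Maxima may lie on the boundary of the feasible set, so only one-sided derivatives are
  available. The price inequalities below come from suitable directions
  \<open>(a, b, e)\<close>.\<close>

lemma maximal_directional:
  assumes m: "maximal v k z" and "0 < s0"
    and feas: "\<And>s. 0 < s \<Longrightarrow> s < s0 \<Longrightarrow> feasible (v + s * a) (k + s * b) (z + s * e)"
  shows "e / z + a / (v - d) - a / v + t * (b / k - a / v) - \<nu> * (e - b + a) - \<mu> * (b - a) \<le> 0"
proof (rule derivative_nonpos_if_right_max[OF _ \<open>0 < s0\<close>])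
  have "0 < v" "0 < k" "0 < z" "d < v" using maximalD[OF m] d by auto
  then show "((\<lambda>s. L (v + s * a) (k + s * b) (z + s * e)) has_real_derivative
      e / z + a / (v - d) - a / v + t * (b / k - a / v) - \<nu> * (e - b + a) - \<mu> * (b - a)) (at 0)"
    unfolding L_def by (auto intro!: derivative_eq_intros)
qed (use feas maximalD(5)[OF m] in auto)

lemma segment_feasible:
  assumes "feasible v k z" "feasible v' k' z'" "0 \<le> s" "s \<le> 1"
  shows "feasible (v + s * (v' - v)) (k + s * (k' - k)) (z + s * (z' - z))"
proof -
  have conv: "x + s * (x' - x) \<le> y + s * (y' - y)" if "x \<le> y" "x' \<le> y'" for x x' y y' :: real
  proof -
    have "(1 - s) * x + s * x' \<le> (1 - s) * y + s * y'"
      using assms(3,4) that by (intro add_mono mult_left_mono) auto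
    then show ?thesis by (simp add: algebra_simps)
  qed
  from conv[of 1 v 1 v'] conv[of v k v' k'] conv[of k z k' z'] conv[of z T z' T]
  show ?thesis using assms(1,2) by (auto simp: feasible_def)
qed

text \<open>The part of \<open>L\<close> in \<open>(k, z)\<close> is strictly concave and separate
  from \<open>v\<close>, so the two first-order conditions can be added even if \<open>v\<close> and
  \<open>v'\<close> differ, and the prices cancel. Since \<open>v < k\<close>, a mode can start
  towards \<open>(k', z')\<close> with \<open>v\<close> held fixed.\<close>

lemma active_zk_unique:
  assumes "0 < t" and m: "maximal v k z" "v < k" and m': "maximal v' k' z'" "v' < k'"
  shows "k = k'" and "z = z'"
proof -
  have dir: "(z' - z) / z + t * ((k' - k) / k) - \<nu> * (z' - z - (k' - k)) - \<mu> * (k' - k) \<le> 0"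
    if m: "maximal v k z" "v < k" and m': "maximal v' k' z'" for v k z v' k' z'
  proof -
    \<comment> \<open>The bound 1 stays within the segment, the other one keeps \<open>k\<close>
      above \<open>v\<close>; the added 1 avoids a zero denominator.\<close>
    define s0 where "s0 = min 1 ((k - v) / (\<bar>k' - k\<bar> + 1))"
    have "0 < s0" using m(2) by (simp add: s0_def)
    have "feasible (v + s * 0) (k + s * (k' - k)) (z + s * (z' - z))" if s: "0 < s" "s < s0" for s
    proof -
      have "s * (\<bar>k' - k\<bar> + 1) < k - v" using s by (simp add: s0_def field_simps)
      moreover have "s * (k - k') \<le> s * (\<bar>k' - k\<bar> + 1)" using s(1) by (intro mult_left_mono) auto
      ultimately have "v \<le> k + s * (k' - k)" by (simp add: algebra_simps)
      moreover have "feasible (v + s * (v' - v)) (k + s * (k' - k)) (z + s * (z' - z))"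
        using m m' s by (intro segment_feasible) (auto simp: maximal_def s0_def)
      ultimately show ?thesis using maximalD(1)[OF m(1)] by (auto simp: feasible_def)
    qed
    from maximal_directional[OF m(1) \<open>0 < s0\<close> this] show ?thesis by simp
  qed
  have pos: "0 < k" "0 < k'" "0 < z" "0 < z'" using maximalD[OF m(1)] maximalD[OF m'(1)] by auto
  have "((z' - z) / z - (z' - z) / z') + t * ((k' - k) / k - (k' - k) / k') \<le> 0"
    using dir[OF m m'(1)] dir[OF m' m(1)] by (simp add: algebra_simps diff_divide_distrib)
  moreover have "0 \<le> t * ((k' - k) / k - (k' - k) / k')"
    using inverse_diff_mono(1)[of k k'] pos t by simp
  ultimately have "(z' - z) / z - (z' - z) / z' \<le> 0" "t * ((k' - k) / k - (k' - k) / k') \<le> 0"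
    using inverse_diff_mono(1)[of z z'] pos by linarith+
  then show "k = k'" "z = z'"
    using inverse_diff_mono(2)[of z z'] inverse_diff_mono(2)[of k k'] pos \<open>0 < t\<close>
    by (auto simp: mult_le_0_iff)
qed

text \<open>
  The derivative of \<open>L\<close> in \<open>v\<close> is a quadratic divided by \<open>v (v - d)\<close>, and this quadratic is
  positive at \<open>0\<close>. Two maxima would force three zeros on the positive axis.
\<close>

lemma active_v_not_less:
  assumes m: "maximal v k z" and m': "maximal v' k z" and "v < v'" "v' < k"
  shows False
proof -
  define q where "q x = x - (1 + t) * (x - d) + (\<mu> - \<nu>) * (x * (x - d))" for x
  define g where "g x = 1 / (x - d) - 1 / x - t / x + (\<mu> - \<nu>)" for x
  have q: "q x = x * (x - d) * g x" if "1 \<le> x" for x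
    using that d by (simp add: q_def g_def field_simps)
  have v: "1 \<le> v" and kT: "k \<le> z" "z \<le> T" using maximalD[OF m] by auto
  have der: "((\<lambda>x. L x k z) has_real_derivative g x) (at x)" if "1 \<le> x" for x
    using that d unfolding L_def g_def by (auto intro!: derivative_eq_intros)
  have "L v k z = L v' k z"
    using m m' by (intro antisym) (auto simp: maximal_def)
  moreover obtain w where "v < w" "w < v'" "L v' k z - L v k z = (v' - v) * g w"
    using MVT2[of v v' "\<lambda>x. L x k z" g] der v \<open>v < v'\<close> by auto
  ultimately have w: "v < w" "w < v'" "g w = 0" using \<open>v < v'\<close> by auto
  \<comment> \<open>At \<open>v\<close>, which may be 1, only the rightward direction is sure to be
    feasible; at \<open>v'\<close>, strictly between \<open>v\<close> and \<open>k\<close>, both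
    are.\<close>
  have gv: "g v \<le> 0"
    using maximal_directional[OF m, of "v' - v" 1 0 0] assms v kT
    by (auto simp: g_def feasible_def algebra_simps)
  have "g v' \<le> 0"
    using maximal_directional[OF m', of "k - v'" 1 0 0] assms v kT
    by (auto simp: g_def feasible_def algebra_simps)
  moreover have "- g v' \<le> 0"
    using maximal_directional[OF m', of "v' - v" "-1" 0 0] assms v kT
    by (auto simp: g_def feasible_def algebra_simps)
  ultimately have "g v' = 0" by simp
  have roots: "q w = 0" "q v' = 0" and qv: "q v \<le> 0"
    using q w \<open>g v' = 0\<close> gv v d assms(3) by (auto simp: mult_le_0_iff)
  \<comment> \<open>The roots are \<open>w\<close> and \<open>v'\<close>, so
    \<open>C = m0 * (w * v')\<close> by Vieta. As \<open>C\<close> is positive, so is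
    \<open>m0\<close>, and hence the quadratic is positive at \<open>v\<close>, left of both
    roots.\<close>
  define m0 B C where "m0 = \<mu> - \<nu>" "B = - t - m0 * d" "C = (1 + t) * d"
  have q_eq: "q x = m0 * x\<^sup>2 + B * x + C" for x
    by (simp add: q_def m0_B_C_def algebra_simps power2_eq_square)
  have "(w - v') * (m0 * (w + v') + B) = 0"
    using roots by (simp add: q_eq algebra_simps power2_eq_square)
  then have B: "B = - m0 * (w + v')" using w by simp
  have C: "C = m0 * (w * v')" using roots(1) by (simp add: q_eq B algebra_simps power2_eq_square)
  have "0 < C" using d t by (simp add: m0_B_C_def)
  moreover have "0 < w * v'" using w v by simp
  ultimately have "0 < m0" using C by (metis zero_less_mult_pos2)
  have "q v = m0 * ((w - v) * (v' - v))" by (simp add: q_eq B C algebra_simps power2_eq_square)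
  then show False using qv w \<open>0 < m0\<close> assms(3) by (simp add: mult_le_0_iff)
qed

lemma active_unique:
  assumes "0 < t" "maximal v k z" "v < k" "maximal v' k' z'" "v' < k'"
  shows "v = v' \<and> k = k' \<and> z = z'"
  using active_zk_unique[OF assms] active_v_not_less[of v k z v'] active_v_not_less[of v' k z v] assms
  by fastforce

lemma ln_ratio_strict_mono:
  assumes "1 \<le> v" "v < v'"
  shows "ln (v - d) - ln v < ln (v' - d) - ln v'"
proof -
  have "(v - d) / v < (v' - d) / v'" using assms d by (simp add: field_simps)
  then have "ln ((v - d) / v) < ln ((v' - d) / v')" using assms d by (intro ln_less_cancel_iff[THEN iffD2]) auto
  then show ?thesis using assms d by (simp add: ln_div)
qed

text \<open>Without power for user 2, raising \<open>v\<close> and \<open>k\<close> together to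
  \<open>z\<close> leaves both powers unchanged and increases
  \<open>ln (v - d) - ln v\<close>.\<close>

lemma silent_eq:
  assumes m: "maximal v v z"
  shows "z = v"
proof (rule ccontr)
  assume "z \<noteq> v"
  then have "v < z" "1 \<le> v" "z \<le> T" using maximalD[OF m] by auto
  then have "L z z z \<le> L v v z" by (intro maximalD(5)[OF m]) (auto simp: feasible_def)
  then show False using ln_ratio_strict_mono[of v z] \<open>1 \<le> v\<close> \<open>v < z\<close> by (simp add: L_def)
qed

text \<open>On the diagonal, \<open>L z z z\<close> is \<open>ln (z - d)\<close> plus an affine
  term, hence strictly concave.\<close>

lemma silent_unique:
  assumes m: "maximal z z z" and m': "maximal z' z' z'"
  shows "z = z'"
proof -
  have dir: "(z' - z) / (z - d) - \<nu> * (z' - z) \<le> 0" if "maximal z z z" "maximal z' z' z'" for z z'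
    using maximal_directional[OF that(1), of 1 "z' - z" "z' - z" "z' - z"]
      segment_feasible[of z z z z' z' z'] that by (auto simp: maximal_def)
  have "(z' - z) / (z - d) - (z' - z) / (z' - d) \<le> 0"
    using dir[OF m m'] dir[OF m' m] by (simp add: algebra_simps diff_divide_distrib)
  then show ?thesis
    using inverse_diff_mono(2)[of "z - d" "z' - d"] maximalD[OF m] maximalD[OF m'] d by auto
qed

text \<open>Lowering \<open>k\<close> and \<open>z\<close> together takes power from user 2 and
  leaves user 1 alone.\<close>

lemma active_power_price:
  assumes m: "maximal v k z" "v < k"
  shows "\<mu> \<le> 1 / z + t / k"
proof -
  have "feasible (v + s * 0) (k + s * - 1) (z + s * - 1)" if "0 < s" "s < k - v" for s
    using that maximalD[OF m(1)] by (auto simp: feasible_def)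
  with m show ?thesis using maximal_directional[of v k z "k - v" 0 "- 1" "- 1"] by simp
qed

text \<open>Moving \<open>z\<close> alone changes the power of user 1 outside the part counted in
  \<open>v\<close>. Downwards this needs \<open>k < z\<close>, that is, a nonempty decoded
  part.\<close>

lemma active_interference_price:
  assumes m: "maximal v k z"
  shows "z < T \<Longrightarrow> 1 / z \<le> \<nu>" and "k < z \<Longrightarrow> \<nu> \<le> 1 / z"
proof -
  assume "z < T"
  moreover have "feasible (v + s * 0) (k + s * 0) (z + s * 1)" if "0 < s" "s < T - z" for s
    using that maximalD[OF m] by (auto simp: feasible_def)
  ultimately show "1 / z \<le> \<nu>" using maximal_directional[OF m, of "T - z" 0 0 1] by simp
next
  assume "k < z"
  moreover have "feasible (v + s * 0) (k + s * 0) (z + s * - 1)" if "0 < s" "s < z - k" for s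
    using that maximalD[OF m] by (auto simp: feasible_def)
  ultimately show "\<nu> \<le> 1 / z" using maximal_directional[OF m, of "z - k" 0 0 "-1"] by simp
qed

text \<open>The directions \<open>(0, 1, 1)\<close> and \<open>(1, 1, 1)\<close> give power to user
  2 and to user 1; the latter can be reversed when \<open>1 < z\<close>.\<close>

lemma silent_prices:
  assumes m: "maximal z z z"
  shows "z < T \<Longrightarrow> (1 + t) / z \<le> \<mu>" and "z < T \<Longrightarrow> 1 / (z - d) \<le> \<nu>"
    and "1 < z \<Longrightarrow> \<nu> \<le> 1 / (z - d)"
proof -
  assume z: "z < T"
  have "feasible (z + s * 0) (z + s * 1) (z + s * 1)" if "0 < s" "s < T - z" for s
    using that maximalD[OF m] by (auto simp: feasible_def)
  with z show "(1 + t) / z \<le> \<mu>"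
    using maximal_directional[OF m, of "T - z" 0 1 1] by (simp add: add_divide_distrib)
  have "feasible (z + s * 1) (z + s * 1) (z + s * 1)" if "0 < s" "s < T - z" for s
    using that maximalD[OF m] by (auto simp: feasible_def)
  with z show "1 / (z - d) \<le> \<nu>"
    using maximal_directional[OF m, of "T - z" 1 1 1] by simp
next
  assume z: "1 < z"
  have "feasible (z + s * - 1) (z + s * - 1) (z + s * - 1)" if "0 < s" "s < z - 1" for s
    using that maximalD[OF m] by (auto simp: feasible_def)
  with z show "\<nu> \<le> 1 / (z - d)"
    using maximal_directional[OF m, of "z - 1" "-1" "-1" "-1"] by simp
qed

text \<open>Both modes face the same prices. The price of the second power gives
  \<open>k \<le> z'\<close>; the price \<open>\<nu> = 1 / (z' - d)\<close>, compared with
  \<open>1 / z\<close>, gives \<open>z' = z + d\<close> unless \<open>k = z\<close>. The bound on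
  the mean keeps one mode away from the cap \<open>T\<close>, from which the comparisons
  start.\<close>

lemma two_phase_structure:
  assumes m: "maximal v k z" "v < k" and m': "maximal z' z' z'"
    and mean: "(1 - lam) * z + lam * z' < T - d" "0 \<le> lam" "lam \<le> 1"
  shows "z \<le> z' \<or> k < z" and "z' \<le> z + d" and "z' = z + d \<or> k = z"
proof -
  note F = maximalD[OF m(1)] maximalD[OF m']
  have low: "z < T - d \<or> z' < T - d"
  proof (rule ccontr)
    assume "\<not> ?thesis"
    then have "(1 - lam) * (T - d) + lam * (T - d) \<le> (1 - lam) * z + lam * z'"
      using mean(2,3) by (intro add_mono mult_left_mono) auto
    then show False using mean(1) by (simp add: algebra_simps)
  qed
  have kz: "k \<le> z'" if "z' < T"
  proof -
    have "(1 + t) / z' \<le> 1 / z + t / k"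
      using silent_prices(1)[OF m' that] active_power_price[OF m] by simp
    also have "\<dots> \<le> 1 / k + t / k" using F by (intro add_right_mono divide_left_mono) auto
    also have "\<dots> = (1 + t) / k" by (simp add: add_divide_distrib)
    finally have "k * (1 + t) \<le> z' * (1 + t)" using F m by (simp add: field_simps)
    then show ?thesis using t by (simp add: mult_le_cancel_right)
  qed
  have "1 < z'" using kz F m(2) d low by fastforce
  then have nu': "\<nu> \<le> 1 / (z' - d)" by (rule silent_prices(3)[OF m'])
  have up: "z' - d \<le> z" if "z < T"
  proof -
    have "1 / z \<le> 1 / (z' - d)" using active_interference_price(1)[OF m(1) that] nu' by simp
    then show ?thesis using F d by (simp add: field_simps)
  qed
  have "z' < T"
    using up low F d by linarith
  then have nu: "\<nu> = 1 / (z' - d)" using silent_prices(2)[OF m'] nu' by simp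
  have eq: "z \<le> z' - d" if "k < z"
  proof -
    have "1 / (z' - d) \<le> 1 / z" using active_interference_price(2)[OF m(1) that] nu by simp
    then show ?thesis using F d by (simp add: field_simps)
  qed
  show le: "z \<le> z' \<or> k < z" using kz \<open>z' < T\<close> F by linarith
  show "z' \<le> z + d" using up \<open>z' < T\<close> F d by (cases "z < T") auto
  then show "z' = z + d \<or> k = z" using eq up \<open>z' < T\<close> F d by (cases "k < z") auto
qed

text \<open>A power of price 0 could be raised until \<open>z = T\<close>, with a strict gain in
  \<open>ln z\<close>. By complementary slackness both power constraints of an optimal mixture are
  therefore tight.\<close>

lemma prices_nonzero:
  assumes m: "maximal v k z" and "z < T"
  shows "\<nu> \<noteq> 0" and "\<mu> \<noteq> 0"
proof -
  note F = maximalD[OF m]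
  have lt: "ln z < ln T" using F \<open>z < T\<close> by simp
  show "\<nu> \<noteq> 0"
  proof
    assume "\<nu> = 0"
    have "L v k T \<le> L v k z" using F by (intro F(5)) (auto simp: feasible_def)
    then show False using lt unfolding L_def unfolding \<open>\<nu> = 0\<close> by simp
  qed
  show "\<mu> \<noteq> 0"
  proof
    assume "\<mu> = 0"
    define k' where "k' = k + (T - z)"
    have k': "k \<le> k'" "k' \<le> T" "T - k' = z - k" using F by (auto simp: k'_def)
    then have "L v k' T \<le> L v k z" using F by (intro F(5)) (auto simp: feasible_def)
    moreover have "t * (ln k - ln v) \<le> t * (ln k' - ln v)"
      using k' F t by (intro mult_left_mono) auto
    ultimately show False using lt unfolding L_def unfolding \<open>\<mu> = 0\<close> k'(3) by simp
  qed
qed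

text \<open>With no price on the second rate, \<open>v\<close> and \<open>k\<close> can be raised
  together until \<open>k = z\<close>, at the same powers and with a gain in
  \<open>ln (v - d) - ln v\<close>. What remains is strictly concave in
  \<open>(v, z)\<close>.\<close>

lemma maximal_unique_if_free_rate:
  assumes "t = 0" and m: "maximal v k z" and m': "maximal v' k' z'"
  shows "k = z" "v = v'" "z = z'"
proof -
  have kz: "k = z" if m: "maximal v k z" for v k z
  proof (rule ccontr)
    assume "k \<noteq> z"
    then have "k < z" "1 \<le> v" "v \<le> k" "z \<le> T" using maximalD[OF m] by auto
    define u where "u = z - k + v"
    have "v < u" "u \<le> z" and u: "z - z + u - 1 = z - k + v - 1" "z - u = k - v"
      using \<open>k < z\<close> \<open>v \<le> k\<close> by (auto simp: u_def)
    then have "L u z z \<le> L v k z"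
      using \<open>1 \<le> v\<close> \<open>z \<le> T\<close> by (intro maximalD(5)[OF m]) (auto simp: feasible_def)
    then show False
      using ln_ratio_strict_mono[OF \<open>1 \<le> v\<close> \<open>v < u\<close>] \<open>t = 0\<close> unfolding L_def u by simp
  qed
  show "k = z" by (rule kz[OF m])
  have dir: "(z' - z) / z + ((v' - v) / (v - d) - (v' - v) / v) - \<nu> * (v' - v) - \<mu> * ((z' - z) - (v' - v)) \<le> 0"
    if "maximal v z z" "maximal v' z' z'" for v z v' z'
  proof -
    have "feasible (v + s * (v' - v)) (z + s * (z' - z)) (z + s * (z' - z))" if "0 < s" "s < 1" for s
      using segment_feasible \<open>maximal v z z\<close> \<open>maximal v' z' z'\<close> that by (simp add: maximal_def)
    from maximal_directional[OF that(1) zero_less_one this] show ?thesis using \<open>t = 0\<close> by simp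
  qed
  have M: "maximal v z z" "maximal v' z' z'" using m m' kz by auto
  note F = maximalD[OF M(1)] maximalD[OF M(2)]
  have pos: "0 < z" "0 < z'" "0 < v" "0 < v'" "d < v" "d < v'" using F d by auto
  \<comment> \<open>The analogue of \<open>inverse_diff_mono\<close> for
    \<open>ln (v - d) - ln v\<close>, whose derivative \<open>d / (v * (v - d))\<close>
    decreases.\<close>
  define r where "r = ((v' - v) / (v - d) - (v' - v) / v) - ((v' - v) / (v' - d) - (v' - v) / v')"
  have sum: "((z' - z) / z - (z' - z) / z') + r \<le> 0"
    using dir[OF M] dir[OF M(2,1)] unfolding r_def by (simp add: algebra_simps diff_divide_distrib)
  have "r = d * ((v' - v) * (v' * (v' - d) - v * (v - d))) / (v * (v - d) * (v' * (v' - d)))"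
    using pos unfolding r_def by (simp add: divide_simps) (simp add: algebra_simps)
  also have "(v' - v) * (v' * (v' - d) - v * (v - d)) = (v' - v)\<^sup>2 * (v + v' - d)"
    by (simp add: algebra_simps power2_eq_square)
  finally have r: "r = d * ((v' - v)\<^sup>2 * (v + v' - d)) / (v * (v - d) * (v' * (v' - d)))" .
  have "0 \<le> r" unfolding r using pos d by auto
  moreover have "v = v'" if "r \<le> 0"
    using that pos d unfolding r by (auto simp: divide_le_0_iff mult_le_0_iff)
  ultimately show "v = v'" "z = z'"
    using sum inverse_diff_mono[of z z'] pos by auto
qed

end

section \<open>Reduction of a mixture to two phases\<close>

lemma sum_two_values:
  fixes w h :: "'i \<Rightarrow> real"
  assumes "finite A" "sum w A = 1" "B \<subseteq> A"
    and "\<And>i. i \<in> B \<Longrightarrow> w i \<noteq> 0 \<Longrightarrow> h i = x" "\<And>i. i \<in> A - B \<Longrightarrow> w i \<noteq> 0 \<Longrightarrow> h i = y"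
  shows "(\<Sum>i\<in>A. w i * h i) = (1 - sum w (A - B)) * x + sum w (A - B) * y"
proof -
  have "(\<Sum>i\<in>A. w i * h i) = (\<Sum>i\<in>A - B. w i * h i) + (\<Sum>i\<in>B. w i * h i)"
    using assms(1,3) by (rule sum.subset_diff[rotated])
  also have "(\<Sum>i\<in>A - B. w i * h i) = (\<Sum>i\<in>A - B. w i * y)"
    using assms(5) by (intro sum.cong) auto
  also have "(\<Sum>i\<in>B. w i * h i) = (\<Sum>i\<in>B. w i * x)"
    using assms(4) by (intro sum.cong) auto
  also have "sum w B = 1 - sum w (A - B)"
    using assms(1-3) by (simp add: sum_diff)
  then have "(\<Sum>i\<in>B. w i * x) = (1 - sum w (A - B)) * x" by (simp flip: sum_distrib_right)
  finally show ?thesis by (simp flip: sum_distrib_right)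
qed

text \<open>The window for \<open>r2\<close> makes the Lagrangian method work: its upper end yields
  a Slater point, its lower end excludes \<open>t = 0\<close>. The optimal mixture then collapses to
  one active mode and at most one silent mode, of weight \<open>lam\<close>.\<close>

lemma two_phase_reduction:
  fixes d Q P r2 r12 :: real and n :: nat and w v k z :: "nat \<Rightarrow> real"
  assumes d: "0 < d" "d < 1" and QP: "0 < Q" "0 < P"
    and w: "\<And>i. i \<in> {1..n} \<Longrightarrow> 0 \<le> w i" "sum w {1..n} = 1"
    and vkz: "\<And>i. i \<in> {1..n} \<Longrightarrow> 1 \<le> v i \<and> v i \<le> k i \<and> k i \<le> z i"
    and power: "(\<Sum>i=1..n. w i * (z i - k i + v i - 1)) \<le> Q" "(\<Sum>i=1..n. w i * (k i - v i)) \<le> P"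
    and rate: "r2 \<le> (\<Sum>i=1..n. w i * (ln (k i) - ln (v i)))"
      "r12 \<le> (\<Sum>i=1..n. w i * (ln (z i) + ln (v i - d) - ln (v i)))"
    and r2: "ln (1 + Q + P) - ln (1 + Q) < r2" "r2 < ln (1 + P)"
  obtains lam v1 k1 z1 z2 where "0 \<le> lam" "lam < 1" "1 \<le> v1" "v1 < k1" "k1 \<le> z1"
    "z1 \<le> z2" "z2 \<le> z1 + d" "z2 = z1 + d \<or> k1 = z1"
    "(1 - lam) * (k1 - v1) = P" "(1 - lam) * (z1 - k1 + v1 - 1) + lam * (z2 - 1) = Q"
    "r2 = (1 - lam) * (ln k1 - ln v1)"
    "r12 \<le> (1 - lam) * (ln z1 + ln (v1 - d) - ln v1) + lam * ln (z2 - d)"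
proof -
  \<comment> \<open>Large enough for all given modes, and at least 1 above \<open>1 + Q + P\<close>,
    the largest mean of \<open>z\<close> that the powers allow.\<close>
  define T where "T = 2 + Q + P + (\<Sum>i=1..n. z i)"
  have zpos: "0 \<le> z i" if "i \<in> {1..n}" for i using vkz[OF that] by simp
  have zT: "z i \<le> T" if "i \<in> {1..n}" for i
    using member_le_sum[of i "{1..n}" z] zpos that QP by (simp add: T_def)
  have T: "2 + Q + P \<le> T" using sum_nonneg[of "{1..n}" z] zpos by (simp add: T_def)
  define K where "K = {p. 1 \<le> fst p \<and> fst p \<le> fst (snd p) \<and> fst (snd p) \<le> snd (snd p) \<and> snd (snd p) \<le> T}"
  define f g c1 c2 where
    "f p = ln (snd (snd p)) + ln (fst p - d) - ln (fst p)"
    "g p = ln (fst (snd p)) - ln (fst p)"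
    "c1 p = snd (snd p) - fst (snd p) + fst p - 1"
    "c2 p = fst (snd p) - fst p" for p :: "real \<times> real \<times> real"
  note fg_def = f_g_c1_c2_def
  have "compact K"
  proof -
    have "closed K" unfolding K_def
      by (intro closed_Collect_conj closed_Collect_le continuous_intros)
    then have "compact (({1..T} \<times> {1..T} \<times> {1..T}) \<inter> K)"
      by (intro compact_Int_closed compact_Times compact_Icc)
    moreover have "K \<subseteq> {1..T} \<times> {1..T} \<times> {1..T}" by (auto simp: K_def)
    ultimately show ?thesis by (simp add: Int_absorb1)
  qed
  have Kpos: "fst p \<noteq> 0 \<and> fst (snd p) \<noteq> 0 \<and> snd (snd p) \<noteq> 0 \<and> fst p - d \<noteq> 0" if "p \<in> K" for p
    using that d by (auto simp: K_def)
  have cont: "continuous_on K f" "continuous_on K g" "continuous_on K c1" "continuous_on K c2"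
    unfolding fg_def using Kpos by (auto intro!: continuous_intros)
  \<comment> \<open>Midway between \<open>P\<close> and \<open>exp r2 - 1\<close>, the power that
    gives rate \<open>r2\<close> without interference. With user 1 off, this is the Slater
    point.\<close>
  define y0 where "y0 = (exp r2 - 1 + P) / 2"
  have "0 < ln (1 + Q + P) - ln (1 + Q)" using QP by simp
  then have "0 < r2" using r2(1) by linarith
  have "exp r2 < 1 + P" using r2(2) QP by (metis add_pos_pos exp_less_cancel_iff exp_ln zero_less_one)
  moreover have "1 < exp r2" using \<open>0 < r2\<close> by simp
  ultimately have y0: "exp r2 < 1 + y0" "y0 < P" "0 < y0"
    unfolding y0_def by (simp_all add: field_simps del: one_less_exp_iff)
  have "ln (exp r2) < ln (1 + y0)" using y0 by (intro ln_less_cancel_iff[THEN iffD2]) auto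
  then have slater: "(1, 1 + y0, 1 + y0) \<in> K" "r2 < g (1, 1 + y0, 1 + y0)"
      "c1 (1, 1 + y0, 1 + y0) < Q" "c2 (1, 1 + y0, 1 + y0) < P"
    using y0 QP T by (auto simp: K_def fg_def)
  define p where "p i = (v i, k i, z i)" for i
  have start: "\<forall>i\<in>{1..n}. 0 \<le> w i \<and> p i \<in> K"
    "r2 \<le> (\<Sum>i=1..n. w i * g (p i))" "(\<Sum>i=1..n. w i * c1 (p i)) \<le> Q" "(\<Sum>i=1..n. w i * c2 (p i)) \<le> P"
    "r12 \<le> (\<Sum>i=1..n. w i * f (p i))"
    using w vkz zT power rate by (auto simp: K_def fg_def p_def)
  obtain m u q t \<nu> \<mu> where u: "\<forall>i\<in>{1..m}. 0 \<le> u i \<and> q i \<in> K" "sum u {1..m::nat} = 1"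
    and qle: "r2 \<le> (\<Sum>i=1..m. u i * g (q i))" "(\<Sum>i=1..m. u i * c1 (q i)) \<le> Q" "(\<Sum>i=1..m. u i * c2 (q i)) \<le> P"
    and qf: "(\<Sum>i=1..n. w i * f (p i)) \<le> (\<Sum>i=1..m. u i * f (q i))"
    and nn: "0 \<le> t" "0 \<le> \<nu>" "0 \<le> \<mu>"
    and slack: "0 < t \<longrightarrow> (\<Sum>i=1..m. u i * g (q i)) = r2" "0 < \<nu> \<longrightarrow> (\<Sum>i=1..m. u i * c1 (q i)) = Q"
      "0 < \<mu> \<longrightarrow> (\<Sum>i=1..m. u i * c2 (q i)) = P"
    and opt: "\<forall>i\<in>{1..m}. 0 < u i \<longrightarrow> (\<forall>s\<in>K.
       f s + t * g s - \<nu> * c1 s - \<mu> * c2 s \<le> f (q i) + t * g (q i) - \<nu> * c1 (q i) - \<mu> * c2 (q i))"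
    by (rule optimal_mixture_multipliers[OF \<open>compact K\<close> cont slater start(1) w(2) start(2-4)])
  interpret hk_lagrangian d t \<nu> \<mu> T using d nn by unfold_locales
  have u0: "0 \<le> u i" if "i \<in> {1..m}" for i using u(1) that by blast
  define V Kk Z where "V i = fst (q i)" "Kk i = fst (snd (q i))" "Z i = snd (snd (q i))" for i
  have mx: "maximal (V i) (Kk i) (Z i)" if "i \<in> {1..m}" "u i \<noteq> 0" for i
  proof -
    have "0 \<le> u i \<and> q i \<in> K" using u(1) that(1) by blast
    with that(2) have "0 < u i" "q i \<in> K" by auto
    then show ?thesis
      using opt[rule_format, OF that(1) \<open>0 < u i\<close>, of "(_, _, _)"]
      by (auto simp: maximal_def feasible_def L_def K_def V_Kk_Z_def fg_def)
  qed
  have sumZ: "(\<Sum>i=1..m. u i * Z i) = (\<Sum>i=1..m. u i * c1 (q i)) + (\<Sum>i=1..m. u i * c2 (q i)) + 1"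
    using u(2) by (simp add: fg_def V_Kk_Z_def algebra_simps sum.distrib sum_subtractf)
  \<comment> \<open>The mean of \<open>Z\<close> is below \<open>T\<close>, so some used mode stays
    below the cap; it shows that both prices are positive.\<close>
  obtain j where j: "j \<in> {1..m}" "u j \<noteq> 0" "Z j < T"
  proof (rule ccontr)
    assume "\<not> thesis"
    with that have or: "u i = 0 \<or> T \<le> Z i" if "i \<in> {1..m}" for i using that by force
    have "u i * T \<le> u i * Z i" if "i \<in> {1..m}" for i
      using or[OF that] u0[OF that] by (auto intro: mult_left_mono)
    then have "(\<Sum>i=1..m. u i * T) \<le> (\<Sum>i=1..m. u i * Z i)" by (rule sum_mono)
    moreover have "(\<Sum>i=1..m. u i * T) = T" using u(2) by (simp flip: sum_distrib_right)
    ultimately show False using sumZ qle T by linarith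
  qed
  have "0 < \<nu>" "0 < \<mu>" using prices_nonzero[OF mx[OF j(1,2)] j(3)] nn by auto
  then have exQ: "(\<Sum>i=1..m. u i * c1 (q i)) = Q" and exP: "(\<Sum>i=1..m. u i * c2 (q i)) = P"
    using slack by auto
  define B where "B = {i\<in>{1..m}. V i < Kk i}"
  have "\<exists>i\<in>B. u i \<noteq> 0"
  proof (rule ccontr)
    assume "\<not> ?thesis"
    then have inactive: "u i = 0 \<or> Kk i \<le> V i" if "i \<in> {1..m}" for i
      using that by (force simp: B_def)
    have "u i * c2 (q i) = 0" if "i \<in> {1..m}" for i
      using inactive[OF that] mx[OF that] maximalD(2)[of "V i" "Kk i" "Z i"]
      unfolding fg_def V_Kk_Z_def[symmetric] by fastforce
    then have "(\<Sum>i=1..m. u i * c2 (q i)) = 0" by (intro sum.neutral) auto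
    then show False using exP QP by simp
  qed
  then obtain i0 where i0: "i0 \<in> {1..m}" "u i0 \<noteq> 0" "V i0 < Kk i0" by (auto simp: B_def)
  note m0 = mx[OF i0(1,2)]
  \<comment> \<open>For \<open>t = 0\<close> all used modes coincide and have \<open>k = z\<close>.
    The tight powers then fix \<open>v = 1 + Q\<close> and \<open>k = 1 + Q + P\<close>, so the
    second rate falls short of \<open>r2\<close>.\<close>
  have "t \<noteq> 0"
  proof
    assume "t = 0"
    note uniq = maximal_unique_if_free_rate[OF \<open>t = 0\<close> m0]
    have same: "q i = q i0" if "i \<in> {1..m}" "u i \<noteq> 0" for i
      using uniq[OF mx[OF that]] maximal_unique_if_free_rate(1)[OF \<open>t = 0\<close> mx[OF that] m0]
      by (auto simp: V_Kk_Z_def prod_eq_iff)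
    have const: "(\<Sum>i=1..m. u i * h (q i)) = h (q i0)" for h
      using sum_two_values[of "{1..m}" u "{1..m}" "\<lambda>i. h (q i)" "h (q i0)" "h (q i0)"] u(2) same by simp
    have "fst (snd (q i0)) = 1 + Q + P" "fst (q i0) = 1 + Q"
      using exQ exP uniq(1)[OF m0] unfolding const by (auto simp: fg_def V_Kk_Z_def)
    then show False using qle(1) r2(1) unfolding const by (simp add: fg_def)
  qed
  with nn have "0 < t" by simp
  define lam where "lam = sum u ({1..m} - B)"
  have "0 \<le> lam" unfolding lam_def using u0 by (intro sum_nonneg) auto
  have "sum u {1..m} = lam + sum u B"
    unfolding lam_def by (rule sum.subset_diff) (auto simp: B_def)
  moreover have "0 < sum u B"
    using i0 u0 by (intro sum_pos2[of _ i0]) (auto simp: B_def less_le)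
  ultimately have "lam < 1" using u(2) by simp
  have act: "q i = q i0" if "i \<in> B" "u i \<noteq> 0" for i
    using active_unique[OF \<open>0 < t\<close> mx _ m0 i0(3), of i] that by (auto simp: B_def V_Kk_Z_def prod_eq_iff)
  have sil: "q i = (Z i, Z i, Z i) \<and> maximal (Z i) (Z i) (Z i)" if "i \<in> {1..m} - B" "u i \<noteq> 0" for i
  proof -
    have mi: "maximal (V i) (Kk i) (Z i)" using mx that by blast
    have "Kk i = V i" using maximalD(2)[OF mi] that by (auto simp: B_def)
    moreover then have "Z i = V i" using silent_eq mi by simp
    ultimately show ?thesis using mi by (auto simp: V_Kk_Z_def prod_eq_iff)
  qed
  \<comment> \<open>If no silent mode is used, \<open>lam\<close> is 0 and \<open>z2\<close> is a
    filler chosen to fit the structural conditions.\<close>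
  obtain z2 where z2: "\<And>i. i \<in> {1..m} - B \<Longrightarrow> u i \<noteq> 0 \<Longrightarrow> q i = (z2, z2, z2)"
    and z2': "maximal z2 z2 z2 \<or> lam = 0 \<and> z2 = Z i0 + d"
  proof (cases "\<exists>i\<in>{1..m} - B. u i \<noteq> 0")
    case True
    then obtain j where j: "j \<in> {1..m} - B" "u j \<noteq> 0" by blast
    have "q i = (Z j, Z j, Z j)" if "i \<in> {1..m} - B" "u i \<noteq> 0" for i
      using sil[OF that] sil[OF j] silent_unique[of "Z i" "Z j"] by simp
    with sil[OF j] show thesis using that[of "Z j"] by blast
  next
    case False
    then have "lam = 0" unfolding lam_def by (intro sum.neutral) auto
    then show thesis using that[of "Z i0 + d"] False by blast
  qed
  have mix: "(\<Sum>i=1..m. u i * h (q i)) = (1 - lam) * h (q i0) + lam * h (z2, z2, z2)" for h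
    unfolding lam_def using u(2) act z2
    by (intro sum_two_values) (auto simp: B_def)
  have P_eq: "(1 - lam) * (Kk i0 - V i0) = P"
    using exP unfolding mix by (simp add: fg_def V_Kk_Z_def)
  have Q_eq: "(1 - lam) * (Z i0 - Kk i0 + V i0 - 1) + lam * (z2 - 1) = Q"
    using exQ unfolding mix by (simp add: fg_def V_Kk_Z_def)
  have mean: "(1 - lam) * Z i0 + lam * z2 < T - d"
    using P_eq Q_eq T d by (simp add: algebra_simps)
  have struct: "Z i0 \<le> z2" "z2 \<le> Z i0 + d" "z2 = Z i0 + d \<or> Kk i0 = Z i0"
  proof -
    have "Z i0 \<le> z2 \<and> z2 \<le> Z i0 + d \<and> (z2 = Z i0 + d \<or> Kk i0 = Z i0)"
    proof (cases "maximal z2 z2 z2")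
      case True
      then show ?thesis
        using two_phase_structure[OF m0 i0(3) _ mean \<open>0 \<le> lam\<close>] \<open>lam < 1\<close> d by fastforce
    next
      case False
      then show ?thesis using z2' d by auto
    qed
    then show "Z i0 \<le> z2" "z2 \<le> Z i0 + d" "z2 = Z i0 + d \<or> Kk i0 = Z i0" by auto
  qed
  \<comment> \<open>Equality, due to \<open>0 < t\<close>, matters: subtracting it turns the bound
    on the sum rate into one on the first rate.\<close>
  have rate2: "r2 = (1 - lam) * (ln (Kk i0) - ln (V i0))"
    using slack(1) \<open>0 < t\<close> unfolding mix by (simp add: fg_def V_Kk_Z_def)
  have rate12: "r12 \<le> (1 - lam) * (ln (Z i0) + ln (V i0 - d) - ln (V i0)) + lam * ln (z2 - d)"
    using order_trans[OF start(5) qf] unfolding mix by (simp add: fg_def V_Kk_Z_def)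
  show thesis
    by (rule that[OF \<open>0 \<le> lam\<close> \<open>lam < 1\<close> _ i0(3) _ struct P_eq Q_eq rate2 rate12])
       (use maximalD[OF m0] in auto)
qed

section \<open>From mixtures to the noiseberg region\<close>

text \<open>The dictionary is \<open>v = 1 + c * nb_pA\<close>,
  \<open>k = v + P2 / (1 - lam)\<close>, \<open>z1 = k + c * nb_pC\<close> and
  \<open>z2 = 1 + c * nb_pB\<close>. Rates are scaled by \<open>2 * ln b\<close>, and
  \<open>ln c\<close> comes from \<open>1 + p = (1 + c * p - (1 - c)) / c\<close>.\<close>

lemma noiseberg_regionI:
  fixes a b P1 P2 lam v k z1 z2 R1 R2 :: real
  defines "c \<equiv> a\<^sup>2"
  assumes b: "1 < b" and a: "0 < a" "a < 1" and lam: "0 \<le> lam" "lam < 1"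
    and ord: "1 \<le> v" "v \<le> k" "k \<le> z1" "z1 \<le> z2" "z2 \<le> z1 + (1 - c)" "z2 = z1 + (1 - c) \<or> k = z1"
    and power: "(1 - lam) * (k - v) = P2" "(1 - lam) * (z1 - k + v - 1) + lam * (z2 - 1) = c * P1"
    and R: "0 \<le> R1" "0 \<le> R2"
    and rate: "2 * ln b * R2 \<le> (1 - lam) * (ln k - ln v)"
      "2 * ln b * R1 + ln c \<le> (1 - lam) * (ln (v - (1 - c)) + ln z1 - ln k) + lam * ln (z2 - (1 - c))"
  shows "(R1, R2) \<in> noiseberg_region b a P1 P2"
proof -
  have c: "0 < c" "c < 1" using a by (auto simp: c_def power_less_one_iff)
  \<comment> \<open>If \<open>z2 = z1 + (1 - c)\<close>, this \<open>h\<close> is at or above the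
    threshold \<open>(1 - c) / c\<close>; if \<open>k = z1\<close>, it is at or below. Both cases
    give the same formulas for the minimum and the maximum.\<close>
  define h where "h = (z2 - k) / c"
  have s: "min h ((1 - c) / c) = (z2 - z1) / c" "max 0 (h - (1 - c) / c) = (z1 - k) / c"
    using ord(6)
  proof (atomize(full), elim disjE, goal_cases)
    case 1
    have "(z2 - k) / c = (1 - c) / c + (z1 - k) / c" by (simp add: 1 add_divide_distrib[symmetric])
    moreover have "0 \<le> (z1 - k) / c" using ord c by simp
    ultimately show ?case by (simp add: h_def 1)
  next
    case 2
    have "h = (z2 - z1) / c" by (simp add: h_def 2)
    moreover have "(z2 - z1) / c \<le> (1 - c) / c" using ord c by (intro divide_right_mono) auto
    ultimately show ?case by (simp add: 2)
  qed
  have y: "P2 / (1 - lam) = k - v" using power(1) lam by (simp add: field_simps)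
  have P1: "P1 = ((1 - lam) * (z1 - k + v - 1) + lam * (z2 - 1)) / c" using power(2) c by simp
  have "nb_pA a P1 P2 lam h = P1 - lam * (P2 / (1 - lam)) / c - lam * ((z2 - z1) / c) - (z1 - k) / c"
    using s by (simp add: nb_pA_def c_def mult.commute)
  also have "\<dots> = (v - 1) / c"
    unfolding y P1 using c by (simp add: field_simps)
  finally have pA: "nb_pA a P1 P2 lam h = (v - 1) / c" .
  have pC: "nb_pC a h = (z1 - k) / c" using s by (simp add: nb_pC_def c_def)
  have "nb_pB a P1 P2 lam h = P1 + P2 / c + (1 - lam) * ((z2 - z1) / c)"
    using s by (simp add: nb_pB_def c_def)
  also have "\<dots> = (z2 - 1) / c"
    unfolding P1 power(1)[symmetric] using c by (simp add: field_simps)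
  finally have pB: "nb_pB a P1 P2 lam h = (z2 - 1) / c" .
  define S1 S2 S3 where
    "S1 = 1/2 * log b (1 + (v - 1) / c) + 1/2 * log b (1 + c * ((z1 - k) / c) / (1 + c * ((v - 1) / c) + (k - v)))"
    "S2 = 1/2 * log b (1 + (k - v) / (1 + c * ((v - 1) / c)))"
    "S3 = 1/2 * log b (1 + (z2 - 1) / c)"
  have arg: "1 + (v - 1) / c = (v - (1 - c)) / c" "1 + (z2 - 1) / c = (z2 - (1 - c)) / c"
    "1 + c * ((v - 1) / c) = v"
    using c by (auto simp: field_simps)
  have arg': "1 + c * ((z1 - k) / c) / (v + (k - v)) = z1 / k" "1 + (k - v) / v = k / v"
    using c ord by (auto simp: field_simps)
  have pos: "0 < v" "0 < k" "0 < z1" "0 < v - (1 - c)" "0 < z2 - (1 - c)" using ord c by auto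
  have S1: "2 * ln b * S1 = ln (v - (1 - c)) + ln z1 - ln k - ln c"
    unfolding S1_S2_S3_def arg arg' using pos c b by (simp add: log_def ln_div field_simps)
  have S2: "2 * ln b * S2 = ln k - ln v"
    unfolding S1_S2_S3_def arg arg' using pos c b by (simp add: log_def ln_div field_simps)
  have S3: "2 * ln b * S3 = ln (z2 - (1 - c)) - ln c"
    unfolding S1_S2_S3_def arg arg' using pos c b by (simp add: log_def ln_div field_simps)
  have lb: "0 < 2 * ln b" using b by simp
  have "0 \<le> S1"
    unfolding S1_S2_S3_def arg arg' using ord c b by (auto intro!: add_nonneg_nonneg zero_le_log_cancel_iff[THEN iffD2])
  have "0 \<le> S2"
    unfolding S1_S2_S3_def arg arg' using ord c b by (auto intro!: zero_le_log_cancel_iff[THEN iffD2])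
  have "0 \<le> S3"
    unfolding S1_S2_S3_def arg arg' using ord c b by (auto intro!: zero_le_log_cancel_iff[THEN iffD2])
  have "2 * ln b * ((1 - lam) * S2) = (1 - lam) * (2 * ln b * S2)" by (simp add: algebra_simps)
  then have "2 * ln b * R2 \<le> 2 * ln b * ((1 - lam) * S2)" using rate(1) unfolding S2 by linarith
  then have R2: "R2 \<le> (1 - lam) * S2" using lb by (simp only: mult_le_cancel_left_pos)
  have "2 * ln b * ((1 - lam) * S1 + lam * S3) = (1 - lam) * (2 * ln b * S1) + lam * (2 * ln b * S3)"
    by (simp add: algebra_simps)
  also have "\<dots> = (1 - lam) * (ln (v - (1 - c)) + ln z1 - ln k) + lam * ln (z2 - (1 - c)) - ln c"
    unfolding S1 S3 by (simp add: algebra_simps)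
  finally have "2 * ln b * R1 \<le> 2 * ln b * ((1 - lam) * S1 + lam * S3)" using rate(2) by linarith
  then have R1: "R1 \<le> (1 - lam) * S1 + lam * S3" using lb by (simp only: mult_le_cancel_left_pos)
  have "0 \<le> h" using ord c by (simp add: h_def)
  moreover have "0 \<le> nb_P1A a P1 P2 lam h" using lam ord c by (simp add: nb_P1A_def pA)
  ultimately have adm: "nb_admissible a P1 P2 lam h" using lam by (simp add: nb_admissible_def)
  have "S1 \<le> 1/2 * log b (1 + nb_pA a P1 P2 lam h)
      + 1/2 * log b (1 + a\<^sup>2 * nb_pC a h / (1 + a\<^sup>2 * nb_pA a P1 P2 lam h + P2 / (1 - lam)))"
    "S2 \<le> 1/2 * log b (1 + (P2 / (1 - lam)) / (1 + a\<^sup>2 * nb_pA a P1 P2 lam h))"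
    "S3 \<le> 1/2 * log b (1 + nb_pB a P1 P2 lam h)"
    unfolding pA pB pC y S1_S2_S3_def c_def by (rule order_refl)+
  then show ?thesis
    unfolding noiseberg_region_def mem_Collect_eq prod.case
    by (intro conjI exI[of _ lam] exI[of _ h] exI[of _ S1] exI[of _ S2] exI[of _ S3]
        adm R R1 R2 \<open>0 \<le> S1\<close> \<open>0 \<le> S2\<close> \<open>0 \<le> S3\<close>)
qed

text \<open>There are three ranges of \<open>R2\<close>. Up to the rate reached with all of the
  first signal treated as noise, Jensen's inequality for \<open>R1\<close> suffices. At the largest
  scaled rate \<open>ln (1 + P2)\<close>, equality in Jensen's inequality fixes the modes. In
  between, \<open>two_phase_reduction\<close> applies.\<close>

lemma noiseberg_region_if_mixture:
  fixes a b P1 P2 R1 R2 :: real and n :: nat and w v k z :: "nat \<Rightarrow> real"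
  defines "c \<equiv> a\<^sup>2"
  assumes b: "1 < b" and a: "0 < a" "a < 1" and P: "0 < P1" "0 < P2"
    and w: "\<And>i. i \<in> {1..n} \<Longrightarrow> 0 \<le> w i" "sum w {1..n} = 1"
    and vkz: "\<And>i. i \<in> {1..n} \<Longrightarrow> 1 \<le> v i \<and> v i \<le> k i \<and> k i \<le> z i"
    and power: "(\<Sum>i=1..n. w i * (z i - k i + v i - 1)) \<le> c * P1" "(\<Sum>i=1..n. w i * (k i - v i)) \<le> P2"
    and R: "0 \<le> R1" "0 \<le> R2"
    and rate1: "2 * ln b * R1 + ln c \<le> (\<Sum>i=1..n. w i * ln (z i - k i + v i - (1 - c)))"
    and rate2: "2 * ln b * R2 \<le> (\<Sum>i=1..n. w i * (ln (k i) - ln (v i)))"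
    and rate12: "2 * ln b * (R1 + R2) + ln c \<le> (\<Sum>i=1..n. w i * (ln (z i) + ln (v i - (1 - c)) - ln (v i)))"
  shows "(R1, R2) \<in> noiseberg_region b a P1 P2"
proof -
  have c: "0 < c" "c < 1" using a by (auto simp: c_def power_less_one_iff)
  have Q: "0 < c * P1" using c P by simp
  consider (low) "2 * ln b * R2 \<le> ln (1 + c * P1 + P2) - ln (1 + c * P1)"
    | (mid) "ln (1 + c * P1 + P2) - ln (1 + c * P1) < 2 * ln b * R2" "2 * ln b * R2 < ln (1 + P2)"
    | (high) "ln (1 + P2) \<le> 2 * ln b * R2" by linarith
  then show ?thesis
  proof cases
    case low
    have "(\<Sum>i=1..n. w i * ln (z i - k i + v i - (1 - c))) \<le> ln (c * (1 + P1))"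
    proof (rule ln_jensen(1)[OF _ w])
      have "(\<Sum>i=1..n. w i * (z i - k i + v i - (1 - c))) = (\<Sum>i=1..n. w i * (z i - k i + v i - 1)) + c * sum w {1..n}"
        by (simp add: algebra_simps sum.distrib sum_subtractf sum_distrib_left)
      then show "(\<Sum>i=1..n. w i * (z i - k i + v i - (1 - c))) \<le> c * (1 + P1)"
        using power(1) w(2) by (simp add: algebra_simps)
    qed (use c P vkz in force)+
    then have "2 * ln b * R1 + ln c \<le> ln (1 + c * P1 - (1 - c))"
      using rate1 by (simp add: algebra_simps)
    \<comment> \<open>A single phase in which receiver 2 treats the whole first signal as noise,
      hence \<open>k = z1\<close>.\<close>
    then show ?thesis
      using noiseberg_regionI[OF b a, of 0 "1 + c * P1" "1 + c * P1 + P2" "1 + c * P1 + P2" "1 + c * P1 + P2" P2 P1 R1 R2]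
        low P Q c R by (simp add: c_def)
  next
    case mid
    obtain lam v1 k1 z1 z2 where "0 \<le> lam" "lam < 1" "1 \<le> v1" "v1 < k1" "k1 \<le> z1"
      "z1 \<le> z2" "z2 \<le> z1 + (1 - c)" "z2 = z1 + (1 - c) \<or> k1 = z1"
      "(1 - lam) * (k1 - v1) = P2" "(1 - lam) * (z1 - k1 + v1 - 1) + lam * (z2 - 1) = c * P1"
      and r2: "2 * ln b * R2 = (1 - lam) * (ln k1 - ln v1)"
      and r12: "2 * ln b * (R1 + R2) + ln c
        \<le> (1 - lam) * (ln z1 + ln (v1 - (1 - c)) - ln v1) + lam * ln (z2 - (1 - c))"
      by (rule two_phase_reduction[of "1 - c" "c * P1" P2 n w v k z "2 * ln b * R2" "2 * ln b * (R1 + R2) + ln c"])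
         (use c Q P w vkz power rate2 rate12 mid in auto)
    moreover have "2 * ln b * R1 + ln c \<le> (1 - lam) * (ln (v1 - (1 - c)) + ln z1 - ln k1) + lam * ln (z2 - (1 - c))"
      using r2 r12 by (simp add: algebra_simps)
    ultimately show ?thesis
      using R unfolding c_def by (intro noiseberg_regionI[OF b a, of lam v1 k1 z1 z2]) auto
  next
    case high
    \<comment> \<open>\<open>g\<close> compares the second rate of a mode with that at equal power
      and no interference. At the maximal rate both this gap and the gap in Jensen's inequality
      close, so \<open>v = 1\<close> in every used mode.\<close>
    define g where "g i = ln (k i) - ln (v i) - ln (1 + (k i - v i))" for i
    have ratio: "k i / v i = 1 + (k i - v i) / v i" if "i \<in> {1..n}" for i
      using vkz[OF that] by (simp add: field_simps)
    have g_le: "g i \<le> 0" if "i \<in> {1..n}" for i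
    proof -
      have "k i / v i \<le> 1 + (k i - v i)"
        unfolding ratio[OF that] using vkz[OF that] by (simp add: divide_le_eq mult_le_cancel_left1)
      then have "ln (k i / v i) \<le> ln (1 + (k i - v i))" using vkz[OF that] by simp
      then show ?thesis using vkz[OF that] by (simp add: g_def ln_div)
    qed
    have sum1: "(\<Sum>i=1..n. w i * (1 + (k i - v i))) \<le> 1 + P2"
      using power(2) w(2) by (simp add: distrib_left sum.distrib)
    have pos1: "0 < 1 + (k i - v i)" if "i \<in> {1..n}" for i using vkz[OF that] by simp
    have "0 < 1 + P2" using P by simp
    note jen = ln_jensen[OF _ w pos1 sum1 \<open>0 < 1 + P2\<close>]
    have sumg: "(\<Sum>i=1..n. w i * g i) = (\<Sum>i=1..n. w i * (ln (k i) - ln (v i))) - (\<Sum>i=1..n. w i * ln (1 + (k i - v i)))"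
      by (simp add: g_def right_diff_distrib sum_subtractf)
    have "(\<Sum>i=1..n. w i * g i) \<le> 0"
      using w(1) g_le by (intro sum_nonpos) (auto intro: mult_nonneg_nonpos)
    then have lower: "ln (1 + P2) \<le> (\<Sum>i=1..n. w i * ln (1 + (k i - v i)))"
      using high rate2 sumg by linarith
    have r2: "2 * ln b * R2 \<le> ln (1 + P2)"
      using rate2 \<open>_ \<le> 0\<close> sumg jen(1) by simp
    have "v i = 1" if i: "i \<in> {1..n}" "w i \<noteq> 0" for i
    proof -
      have "0 < w i" using w(1) i by force
      have "g i = 0"
        using sum_weighted_eq_bound[of "{1..n}" w g 0 i] w g_le i(1) \<open>0 < w i\<close> sumg rate2 high jen(1) by simp
      then have ln_eq: "ln (k i / v i) = ln (1 + (k i - v i))" using vkz[OF i(1)] by (simp add: g_def ln_div)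
      have "k i / v i = 1 + (k i - v i)"
        by (rule ln_inj_iff[THEN iffD1, OF _ _ ln_eq]) (use vkz[OF i(1)] in auto)
      then have "(k i - v i) / v i = k i - v i" using ratio[OF i(1)] by simp
      moreover have "k i - v i = P2" using jen(2)[OF _ _ _ lower i(1) \<open>0 < w i\<close>] by simp
      ultimately show ?thesis using P vkz[OF i(1)] by (simp add: field_simps)
    qed
    then have "w i * (ln (z i) + ln (v i - (1 - c)) - ln (v i)) = w i * ln (z i) + w i * ln c" if "i \<in> {1..n}" for i
      using that by (cases "w i = 0") (auto simp: algebra_simps)
    then have "(\<Sum>i=1..n. w i * (ln (z i) + ln (v i - (1 - c)) - ln (v i))) = (\<Sum>i=1..n. w i * ln (z i)) + ln c"
      using w(2) by (simp add: sum.distrib flip: sum_distrib_right)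
    moreover have "(\<Sum>i=1..n. w i * ln (z i)) \<le> ln (1 + c * P1 + P2)"
    proof (rule ln_jensen(1)[OF _ w])
      have "(\<Sum>i=1..n. w i * z i) = (\<Sum>i=1..n. w i * (z i - k i + v i - 1)) + (\<Sum>i=1..n. w i * (k i - v i)) + sum w {1..n}"
        by (simp add: algebra_simps sum.distrib sum_subtractf)
      then show "(\<Sum>i=1..n. w i * z i) \<le> 1 + c * P1 + P2" using power w(2) by simp
    qed (use Q P vkz in force)+
    ultimately have "2 * ln b * R1 \<le> ln (1 + c * P1 + P2) - ln (1 + P2)"
      using rate12 high by (simp add: algebra_simps)
    \<comment> \<open>A single phase in which receiver 2 decodes the whole first signal. As
      \<open>lam = 0\<close>, \<open>z2\<close> is a filler, set to \<open>z1 + (1 - c)\<close>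
      because \<open>k < z1\<close>.\<close>
    then show ?thesis
      using noiseberg_regionI[OF b a, of 0 1 "1 + P2" "1 + c * P1 + P2" "1 + c * P1 + P2 + (1 - c)" P2 P1 R1 R2]
        r2 P Q c R by (simp add: c_def)
  qed
qed

lemma HK_region_subset_noiseberg_region:
  assumes b: "1 < b" and a: "0 < a" "a < 1" and P: "0 < P1" "0 < P2"
  shows "HK_region b a P1 P2 \<subseteq> noiseberg_region b a P1 P2"
proof (rule subrelI)
  fix R1 R2 assume "(R1, R2) \<in> HK_region b a P1 P2"
  then obtain n :: nat and \<alpha> w p1 p2 :: "nat \<Rightarrow> real" where R: "0 \<le> R1" "0 \<le> R2"
    and nonneg: "\<forall>i\<in>{1..n}. 0 \<le> \<alpha> i \<and> \<alpha> i \<le> 1 \<and> 0 \<le> w i \<and> 0 \<le> p1 i \<and> 0 \<le> p2 i"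
    and w: "(\<Sum>i=1..n. w i) = 1"
    and power: "(\<Sum>i=1..n. w i * p1 i) \<le> P1" "(\<Sum>i=1..n. w i * p2 i) \<le> P2"
    and rate1: "R1 \<le> (\<Sum>i=1..n. w i * (1/2 * log b (1 + p1 i)))"
    and rate2: "R2 \<le> (\<Sum>i=1..n. w i * (1/2 * log b (1 + p2 i / (1 + a\<^sup>2 * \<alpha> i * p1 i))))"
    and rate12: "R1 + R2 \<le> (\<Sum>i=1..n. w i *
      (1/2 * log b (1 + (p2 i + a\<^sup>2 * (1 - \<alpha> i) * p1 i) / (1 + a\<^sup>2 * \<alpha> i * p1 i))
       + 1/2 * log b (1 + \<alpha> i * p1 i)))"
    unfolding HK_region_def by blast
  define c where "c = a\<^sup>2"
  have c: "0 < c" "c < 1" using a by (auto simp: c_def power_less_one_iff)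
  define v k z where "v i = 1 + c * \<alpha> i * p1 i" "k i = v i + p2 i" "z i = 1 + c * p1 i + p2 i" for i
  note vkz_def = v_k_z_def
  have cut: "z i - k i = c * (1 - \<alpha> i) * p1 i" "z i - k i + v i = 1 + c * p1 i" "k i - v i = p2 i" for i
    by (simp_all add: vkz_def algebra_simps)
  have vkz: "1 \<le> v i \<and> v i \<le> k i \<and> k i \<le> z i" if "i \<in> {1..n}" for i
  proof -
    have i: "0 \<le> \<alpha> i" "\<alpha> i \<le> 1" "0 \<le> p1 i" "0 \<le> p2 i" using nonneg that by auto
    then have "0 \<le> z i - k i" unfolding cut using c by simp
    then show ?thesis using i c by (simp add: vkz_def)
  qed
  have lb: "0 < ln b" using b by simp
  have scale: "2 * ln b * r \<le> (\<Sum>i=1..n. w i * f' i)"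
    if "r \<le> (\<Sum>i=1..n. w i * f i)" "\<And>i. i \<in> {1..n} \<Longrightarrow> 2 * ln b * f i = f' i" for r and f f' :: "nat \<Rightarrow> real"
  proof -
    have "2 * ln b * r \<le> 2 * ln b * (\<Sum>i=1..n. w i * f i)" using that(1) lb by simp
    also have "\<dots> = (\<Sum>i=1..n. w i * (2 * ln b * f i))" by (simp add: sum_distrib_left mult_ac)
    also have "\<dots> = (\<Sum>i=1..n. w i * f' i)" using that(2) by (intro sum.cong) auto
    finally show ?thesis .
  qed
  \<comment> \<open>The weights add up to 1, so the \<open>ln c\<close> of the modes leaves the sum
    as one constant.\<close>
  have offset: "(\<Sum>i=1..n. w i * (f i - ln c)) = (\<Sum>i=1..n. w i * f i) - ln c" for f
    using w by (simp add: right_diff_distrib sum_subtractf flip: sum_distrib_right)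
  have two_log: "2 * ln b * (1/2 * log b x) = ln x" for x using lb by (simp add: log_def)
  have r1: "2 * ln b * R1 \<le> (\<Sum>i=1..n. w i * (ln (z i - k i + v i - (1 - c)) - ln c))"
  proof (rule scale[OF rate1])
    fix i assume "i \<in> {1..n}"
    then have "0 < 1 + p1 i" using nonneg by force
    moreover have "1 + c * p1 i - (1 - c) = c * (1 + p1 i)" by (simp add: algebra_simps)
    ultimately show "2 * ln b * (1/2 * log b (1 + p1 i)) = ln (z i - k i + v i - (1 - c)) - ln c"
      unfolding two_log cut(2) using c by (simp add: ln_mult)
  qed
  have r2: "2 * ln b * R2 \<le> (\<Sum>i=1..n. w i * (ln (k i) - ln (v i)))"
  proof (rule scale[OF rate2])
    fix i assume i: "i \<in> {1..n}"
    have "1 + p2 i / (1 + a\<^sup>2 * \<alpha> i * p1 i) = k i / v i"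
      using vkz[OF i] by (simp add: vkz_def c_def field_simps)
    then show "2 * ln b * (1/2 * log b (1 + p2 i / (1 + a\<^sup>2 * \<alpha> i * p1 i))) = ln (k i) - ln (v i)"
      unfolding two_log using vkz[OF i] by (simp add: ln_div)
  qed
  have r12: "2 * ln b * (R1 + R2) \<le> (\<Sum>i=1..n. w i * ((ln (z i) + ln (v i - (1 - c)) - ln (v i)) - ln c))"
  proof (rule scale[OF rate12])
    fix i assume i: "i \<in> {1..n}"
    have "1 + a\<^sup>2 * \<alpha> i * p1 i = v i" "p2 i + a\<^sup>2 * (1 - \<alpha> i) * p1 i = z i - v i"
      by (simp_all add: vkz_def c_def algebra_simps)
    then have e1: "1 + (p2 i + a\<^sup>2 * (1 - \<alpha> i) * p1 i) / (1 + a\<^sup>2 * \<alpha> i * p1 i) = z i / v i"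
      using vkz[OF i] by (simp add: field_simps)
    have e2: "1 + \<alpha> i * p1 i = (v i - (1 - c)) / c" using c by (simp add: vkz_def field_simps)
    show "2 * ln b * (1/2 * log b (1 + (p2 i + a\<^sup>2 * (1 - \<alpha> i) * p1 i) / (1 + a\<^sup>2 * \<alpha> i * p1 i))
        + 1/2 * log b (1 + \<alpha> i * p1 i)) = (ln (z i) + ln (v i - (1 - c)) - ln (v i)) - ln c"
      unfolding distrib_left two_log e1 e2 using vkz[OF i] c by (simp add: ln_div)
  qed
  have "(\<Sum>i=1..n. w i * (z i - k i + v i - 1)) = c * (\<Sum>i=1..n. w i * p1 i)"
    unfolding cut(2) by (simp add: sum_distrib_left mult_ac)
  then have p1: "(\<Sum>i=1..n. w i * (z i - k i + v i - 1)) \<le> c * P1" using power(1) c by simp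
  have p2: "(\<Sum>i=1..n. w i * (k i - v i)) \<le> P2" unfolding cut(3) using power(2) .
  have w0: "0 \<le> w i" if "i \<in> {1..n}" for i using nonneg that by blast
  have r1': "2 * ln b * R1 + ln c \<le> (\<Sum>i=1..n. w i * ln (z i - k i + v i - (1 - c)))"
    and r12': "2 * ln b * (R1 + R2) + ln c \<le> (\<Sum>i=1..n. w i * (ln (z i) + ln (v i - (1 - c)) - ln (v i)))"
    using r1 r12 unfolding offset by linarith+
  show "(R1, R2) \<in> noiseberg_region b a P1 P2"
    by (rule noiseberg_region_if_mixture[OF b a P, folded c_def, of n w v k z])
       (fact w0 w vkz p1 p2 R r1' r2 r12')+
qed

section \<open>From the noiseberg region to the Han-Kobayashi region\<close>

text \<open>Two modes suffice. In the first, the powers are \<open>A + C\<close> and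
  \<open>y\<close>, and \<open>A\<close> is the part treated as noise at receiver 2; in the second,
  user 2 is silent and user 1 has power \<open>B\<close>.\<close>

lemma noiseberg_region_subset_HK_region:
  assumes b: "1 < b" and a: "0 < a" "a < 1" and P: "0 < P1" "0 < P2"
  shows "noiseberg_region b a P1 P2 \<subseteq> HK_region b a P1 P2"
proof (rule subrelI)
  fix R1 R2 assume "(R1, R2) \<in> noiseberg_region b a P1 P2"
  then obtain lam h S1 S2 S3 where R: "0 \<le> R1" "0 \<le> R2" and adm: "nb_admissible a P1 P2 lam h"
    and S: "0 \<le> S1" "0 \<le> S2" "0 \<le> S3"
    and R1: "R1 \<le> (1 - lam) * S1 + lam * S3" and R2: "R2 \<le> (1 - lam) * S2"
    and S1: "S1 \<le> 1/2 * log b (1 + nb_pA a P1 P2 lam h)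
      + 1/2 * log b (1 + a\<^sup>2 * nb_pC a h / (1 + a\<^sup>2 * nb_pA a P1 P2 lam h + P2 / (1 - lam)))"
    and S2: "S2 \<le> 1/2 * log b (1 + (P2 / (1 - lam)) / (1 + a\<^sup>2 * nb_pA a P1 P2 lam h))"
    and S3: "S3 \<le> 1/2 * log b (1 + nb_pB a P1 P2 lam h)"
    unfolding noiseberg_region_def by blast
  define c A B C y where "c = a\<^sup>2" "A = nb_pA a P1 P2 lam h" "B = nb_pB a P1 P2 lam h" "C = nb_pC a h"
    "y = P2 / (1 - lam)"
  note defs = c_A_B_C_y_def
  have c: "0 < c" "c < 1" using a by (auto simp: defs power_less_one_iff)
  have lam: "0 \<le> lam" "lam < 1" and "0 \<le> h" using adm by (auto simp: nb_admissible_def)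
  have "0 \<le> A" using adm lam by (simp add: nb_admissible_def nb_P1A_def defs zero_le_mult_iff)
  have "0 \<le> C" by (simp add: defs nb_pC_def)
  have "0 < y" using lam P by (simp add: defs)
  have "0 \<le> B"
    using lam c P \<open>0 \<le> h\<close> by (auto simp: defs nb_pB_def intro!: add_nonneg_nonneg mult_nonneg_nonneg)
  have total: "(1 - lam) * (A + C) + lam * B = P1"
    using nb_power_sum[of a lam P1 P2 h] a lam
    by (simp add: defs nb_P1A_def nb_P1B_def nb_P1C_def algebra_simps)
  define V K where "V = 1 + c * A" "K = 1 + c * A + y"
  have "0 < V" "0 < K" using c \<open>0 \<le> A\<close> \<open>0 < y\<close> by (auto simp: V_K_def add_pos_nonneg)
  have S1': "S1 \<le> 1/2 * log b (1 + A) + 1/2 * log b (1 + c * C / K)"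
    and S2': "S2 \<le> 1/2 * log b (1 + y / V)" and S3': "S3 \<le> 1/2 * log b (1 + B)"
    using S1 S2 S3 by (simp_all add: defs V_K_def)
  have pos: "0 < 1 + c * C / K" "0 < 1 + y / V"
    using c \<open>0 \<le> C\<close> \<open>0 < K\<close> \<open>0 < V\<close> \<open>0 < y\<close> by (auto intro: add_pos_nonneg)
  \<comment> \<open>Hence the layer \<open>C\<close> is received at receiver 2 no better than on top
    of \<open>A\<close> at receiver 1, and the rate of the two layers is at most the single-user
    rate at power \<open>A + C\<close>.\<close>
  have "c * (1 + A) \<le> K" using c \<open>0 < y\<close> by (simp add: V_K_def algebra_simps)
  then have "C * (c * (1 + A)) \<le> C * K" using \<open>0 \<le> C\<close> by (rule mult_left_mono)
  then have "(1 + A) * (1 + c * C / K) \<le> 1 + (A + C)" using \<open>0 < K\<close> by (simp add: field_simps)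
  then have "log b ((1 + A) * (1 + c * C / K)) \<le> log b (1 + (A + C))"
    using b pos \<open>0 \<le> A\<close> \<open>0 \<le> C\<close> by (intro log_mono) auto
  moreover have "log b ((1 + A) * (1 + c * C / K)) = log b (1 + A) + log b (1 + c * C / K)"
    using b pos \<open>0 \<le> A\<close> by (subst log_mult) auto
  ultimately have single: "S1 \<le> 1/2 * log b (1 + (A + C))" using S1' by simp
  \<comment> \<open>The product telescopes, being \<open>(K + c * C) / K\<close> times
    \<open>K / V\<close>.\<close>
  have "(1 + c * C / K) * (1 + y / V) = 1 + (y + c * C) / V"
    using \<open>0 < V\<close> \<open>0 < K\<close> by (simp add: field_simps) (simp add: V_K_def algebra_simps)
  moreover have "log b ((1 + c * C / K) * (1 + y / V)) = log b (1 + c * C / K) + log b (1 + y / V)"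
    using b pos by (subst log_mult) auto
  ultimately have "log b (1 + (y + c * C) / V) = log b (1 + c * C / K) + log b (1 + y / V)" by simp
  then have joint: "S1 + S2 \<le> 1/2 * log b (1 + (y + c * C) / V) + 1/2 * log b (1 + A)"
    using S1' S2' by linarith
  \<comment> \<open>If \<open>A + C = 0\<close>, the quotient is 0 by convention and
    \<open>\<alpha> 1 * p1 1 = A\<close> still holds.\<close>
  define \<alpha> w p1 p2 :: "nat \<Rightarrow> real" where
    "\<alpha> i = (if i = 1 then A / (A + C) else 1)" "w i = (if i = 1 then 1 - lam else lam)"
    "p1 i = (if i = 1 then A + C else B)" "p2 i = (if i = 1 then y else 0)" for i
  note ws = \<alpha>_w_p1_p2_def
  have AC: "\<alpha> 1 * p1 1 = A"
    using \<open>0 \<le> A\<close> \<open>0 \<le> C\<close> by (simp add: ws)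
  have AC1: "c * \<alpha> 1 * p1 1 = c * A" using AC by (simp add: mult.assoc)
  have AC2: "c * (1 - \<alpha> 1) * p1 1 = c * C"
    using AC by (simp add: mult.assoc left_diff_distrib) (simp add: ws)
  have two: "(\<Sum>i=1..2. f i) = f 1 + f 2" for f :: "nat \<Rightarrow> real" by (simp add: numeral_2_eq_2)
  have AC_le: "0 \<le> \<alpha> 1" "\<alpha> 1 \<le> 1" using \<open>0 \<le> A\<close> \<open>0 \<le> C\<close> by (auto simp: ws divide_le_eq_1)
  have "R1 \<le> (\<Sum>i=1..2. w i * (1/2 * log b (1 + p1 i)))"
  proof -
    have "(1 - lam) * S1 + lam * S3 \<le> (1 - lam) * (1/2 * log b (1 + (A + C))) + lam * (1/2 * log b (1 + B))"
      using single S3' lam by (intro add_mono mult_left_mono) auto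
    then show ?thesis using R1 unfolding two by (simp add: ws)
  qed
  moreover have "R2 \<le> (\<Sum>i=1..2. w i * (1/2 * log b (1 + p2 i / (1 + c * \<alpha> i * p1 i))))"
  proof -
    have "(1 - lam) * S2 \<le> (1 - lam) * (1/2 * log b (1 + y / V))"
      using S2' lam by (intro mult_left_mono) auto
    then show ?thesis using R2 unfolding two AC1 by (simp add: ws V_K_def)
  qed
  moreover have "R1 + R2 \<le> (\<Sum>i=1..2. w i *
      (1/2 * log b (1 + (p2 i + c * (1 - \<alpha> i) * p1 i) / (1 + c * \<alpha> i * p1 i)) + 1/2 * log b (1 + \<alpha> i * p1 i)))"
  proof -
    have "(1 - lam) * (S1 + S2) + lam * S3
        \<le> (1 - lam) * (1/2 * log b (1 + (y + c * C) / V) + 1/2 * log b (1 + A)) + lam * (1/2 * log b (1 + B))"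
      using lam by (intro add_mono mult_left_mono[OF joint] mult_left_mono[OF S3']) auto
    moreover have "R1 + R2 \<le> (1 - lam) * (S1 + S2) + lam * S3" using R1 R2 by (simp add: algebra_simps)
    ultimately show ?thesis unfolding two AC AC1 AC2 by (simp add: ws V_K_def)
  qed
  moreover have "(\<Sum>i=1..2. w i) = 1" "(\<Sum>i=1..2. w i * p1 i) \<le> P1" "(\<Sum>i=1..2. w i * p2 i) \<le> P2"
    unfolding two using total lam by (simp_all add: ws) (simp add: defs)
  moreover have "\<forall>i\<in>{1..2}. 0 \<le> \<alpha> i \<and> \<alpha> i \<le> 1 \<and> 0 \<le> w i \<and> 0 \<le> p1 i \<and> 0 \<le> p2 i"
  proof
    fix i :: nat
    show "0 \<le> \<alpha> i \<and> \<alpha> i \<le> 1 \<and> 0 \<le> w i \<and> 0 \<le> p1 i \<and> 0 \<le> p2 i"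
      using AC_le lam \<open>0 \<le> A\<close> \<open>0 \<le> B\<close> \<open>0 \<le> C\<close> \<open>0 < y\<close> by (cases "i = 1") (auto simp: ws)
  qed
  ultimately show "(R1, R2) \<in> HK_region b a P1 P2"
    unfolding HK_region_def mem_Collect_eq prod.case \<open>c = a\<^sup>2\<close>
    using R by (intro conjI exI[of _ "2::nat"] exI[of _ \<alpha>] exI[of _ w] exI[of _ p1] exI[of _ p2]) simp_all
qed

theorem theorem1:
  fixes a b P1 P2 :: real
  assumes "1 < b"
    and "0 < a" and "a < 1"
    and "0 < P1" and "0 < P2"
  shows "noiseberg_region b a P1 P2 = HK_region b a P1 P2"
  using noiseberg_region_subset_HK_region[OF assms] HK_region_subset_noiseberg_region[OF assms]
  by (rule subset_antisym)

end
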